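(* There exists $n_0$ such that for all integers $n \ge n_0$ we have $\dim_{\mathbb{Q}} \mathcal{L}_n = n!-(n-1)^2$, and hence $\mathcal{L}_n=\mathcal{F}_n$.
   Context: $S_n$ is the symmetric group of all permutations of $[n]=\{1,\dots,n\}$, and $\mathbb{Q}[S_n]$ is the free $\mathbb{Q}$-vector space with basis $S_n$. For $\sigma\in S_n$, $P_\sigma$ is the $n\times n$ permutation matrix with $P_\sigma(i,j)=1$ if $\sigma(i)=j$ and $0$ otherwise. $J$ denotes the $n\times n$ all-ones matrix. A latin square of order $n$ is an $n\times n$ array with entries in $[n]$ such that each symbol appears exactly once in every row and every column. It is row-normalized if its first row is $1,2,\dots,n$ in this order. For each symbol $s$, the positions of $s$ in a latin square $L$ form the support of a permutation matrix $P_{\sigma_s}$ (that is, $\sigma_s(i)=j$ if and only if $L$ has symbol $s$ in cell $(i,j)$), and $P_{\sigma_1}+\dots+P_{\sigma_n}=J$. A row-normalized latin square $L$ is identified with its set of symbol permutations $\{\sigma_1,\dots,\sigma_n\}$, and we write $\sigma\in L$ if $\sigma$ is one of these. It is thereby also identified with the element $\sum_{\sigma\in L}\sigma$ of $\mathbb{Q}[S_n]$. $\mathcal{L}_n\subseteq\mathbb{Q}[S_n]$ is the $\mathbb{Q}$-linear span of the elements $\sum_{\sigma\in L}\sigma$ over all row-normalized latin squares $L$ of order $n$. $\mathcal{F}_n\subseteq\mathbb{Q}[S_n]$ is the subspace of all $\sum_{\sigma\in S_n}c_\sigma\sigma$ such that $\sum_{\sigma\in S_n}c_\sigma P_\sigma=cJ$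 for some $c\in\mathbb{Q}$. *)

theory Defs
  imports
    Complex_Main
    "HOL-Combinatorics.Permutations"
    "HOL-Library.Poly_Mapping"
begin

abbreviation Sym :: "nat \<Rightarrow> (nat \<Rightarrow> nat) set" where
  "Sym n \<equiv> {\<sigma>. \<sigma> permutes {1..n}}"

(* The free rational vector space on the type 'a is 'a =>_0 rat; the basis vector of k is
   Poly_Mapping.single k 1. *)

definition qscale :: "rat \<Rightarrow> ('a \<Rightarrow>\<^sub>0 rat) \<Rightarrow> ('a \<Rightarrow>\<^sub>0 rat)" where
  "qscale c x = Poly_Mapping.map ((*) c) x"

lemma lookup_qscale [simp]: "Poly_Mapping.lookup (qscale c x) k = c * Poly_Mapping.lookup x k"
  by (simp add: qscale_def Poly_Mapping.map.rep_eq when_def)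

interpretation qvs: vector_space qscale
  by unfold_locales (rule poly_mapping_eqI; simp add: lookup_add algebra_simps)+

(* Q[S_n], inside the free vector space on all functions nat => nat. *)

definition QSym :: "nat \<Rightarrow> ((nat \<Rightarrow> nat) \<Rightarrow>\<^sub>0 rat) set" where
  "QSym n = {x. Poly_Mapping.keys x \<subseteq> Sym n}"

(* Matrices are functions of a row and a column index; only indices in {1..n} are ever used. *)

definition perm_matrix :: "(nat \<Rightarrow> nat) \<Rightarrow> nat \<Rightarrow> nat \<Rightarrow> rat" where
  "perm_matrix \<sigma> i j = (if \<sigma> i = j then 1 else 0)"

definition ones_matrix :: "nat \<Rightarrow> nat \<Rightarrow> rat" where
  "ones_matrix i j = 1"

(* L i j is the symbol in row i and column j; values outside {1..n} x {1..n} are irrelevant. *)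

definition latin_square :: "nat \<Rightarrow> (nat \<Rightarrow> nat \<Rightarrow> nat) \<Rightarrow> bool" where
  "latin_square n L \<longleftrightarrow>
     (\<forall>i\<in>{1..n}. \<forall>j\<in>{1..n}. L i j \<in> {1..n}) \<and>
     (\<forall>i\<in>{1..n}. \<forall>s\<in>{1..n}. \<exists>!j. j \<in> {1..n} \<and> L i j = s) \<and>
     (\<forall>j\<in>{1..n}. \<forall>s\<in>{1..n}. \<exists>!i. i \<in> {1..n} \<and> L i j = s)"

definition row_normalized :: "nat \<Rightarrow> (nat \<Rightarrow> nat \<Rightarrow> nat) \<Rightarrow> bool" where
  "row_normalized n L \<longleftrightarrow> (\<forall>j\<in>{1..n}. L 1 j = j)"

definition symbol_perms :: "nat \<Rightarrow> (nat \<Rightarrow> nat \<Rightarrow> nat) \<Rightarrow> (nat \<Rightarrow> nat) set" where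
  "symbol_perms n L =
     {\<sigma> \<in> Sym n. \<exists>s\<in>{1..n}. \<forall>i\<in>{1..n}. \<forall>j\<in>{1..n}. \<sigma> i = j \<longleftrightarrow> L i j = s}"

definition latin_element :: "nat \<Rightarrow> (nat \<Rightarrow> nat \<Rightarrow> nat) \<Rightarrow> ((nat \<Rightarrow> nat) \<Rightarrow>\<^sub>0 rat)" where
  "latin_element n L = (\<Sum>\<sigma>\<in>symbol_perms n L. Poly_Mapping.single \<sigma> 1)"

definition latin_span :: "nat \<Rightarrow> ((nat \<Rightarrow> nat) \<Rightarrow>\<^sub>0 rat) set" where
  "latin_span n = qvs.span {latin_element n L | L. latin_square n L \<and> row_normalized n L}"

definition flat_space :: "nat \<Rightarrow> ((nat \<Rightarrow> nat) \<Rightarrow>\<^sub>0 rat) set" where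
  "flat_space n =
     {x \<in> QSym n. \<exists>c. \<forall>i\<in>{1..n}. \<forall>j\<in>{1..n}.
        (\<Sum>\<sigma>\<in>Sym n. Poly_Mapping.lookup x \<sigma> * perm_matrix \<sigma> i j) = c * ones_matrix i j}"

end

theory Submission
  imports Defs
begin

text \<open>
  Let \<open>f\<close> be the restriction to \<open>S\<^sub>n\<close> of a linear functional that vanishes on all latin squares. Two
  disjoint permutation matrices extend to a latin square (Hall), so \<open>f \<sigma> + f \<tau>\<close> depends only on the
  support of \<open>P\<^sub>\<sigma> + P\<^sub>\<tau>\<close>. For disjoint transpositions \<open>a\<close>, \<open>b\<close> put
  \<open>D \<sigma> = f (\<sigma> a b) - f (\<sigma> a) - f (\<sigma> b) + f \<sigma>\<close>. A derangement \<open>c\<close> of the remaining points gives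
  \<open>D (\<sigma> c) = - D \<sigma>\<close>; taking \<open>c\<close> such that \<open>c\<^sup>2\<close> is a derangement of these points too yields both
  \<open>D (\<sigma> c\<^sup>2) = D \<sigma>\<close> and \<open>D (\<sigma> c\<^sup>2) = - D \<sigma>\<close>, so \<open>D = 0\<close>. Hence \<open>f (\<sigma> (i j)) - f \<sigma>\<close> depends
  only on \<open>\<sigma> i\<close> and \<open>\<sigma> j\<close>. In these two values it is a cocycle, because its defect is invariant under
  \<open>(i, j) \<mapsto> (j, k)\<close> but changes sign under \<open>(i, j) \<mapsto> (j, i)\<close>. Therefore \<open>f\<close> is, up to a constant, a
  sum of functions of the single values \<open>\<sigma> i\<close>, and it vanishes on \<open>\<F>\<^sub>n\<close>. The dimension of \<open>\<F>\<^sub>n\<close>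
  follows since it is cut out of \<open>\<rat>[S\<^sub>n]\<close> by \<open>(n - 1)\<^sup>2\<close> independent linear conditions.
\<close>

section \<open>Decomposing regular relations into permutations\<close>

text \<open>Induction on the size of \<open>I\<close>. If a nonempty proper subfamily is tight, it
  is matched first and its union is removed from the other sets; if none is tight, every nonempty
  proper subfamily has an element to spare, so one arbitrary choice is harmless.\<close>

theorem Hall_marriage:
  fixes A :: "'i \<Rightarrow> 'a set"
  assumes "finite I" and "\<And>i. i \<in> I \<Longrightarrow> finite (A i)"
    and "\<And>J. J \<subseteq> I \<Longrightarrow> card J \<le> card (\<Union>(A ` J))"
  shows "\<exists>f. inj_on f I \<and> (\<forall>i\<in>I. f i \<in> A i)"
  using assms
proof (induction "card I" arbitrary: I A rule: less_induct)
  case less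
  have fin: "finite I" and finA: "\<And>i. i \<in> I \<Longrightarrow> finite (A i)"
    and hall: "\<And>J. J \<subseteq> I \<Longrightarrow> card J \<le> card (\<Union>(A ` J))"
    using less.prems by auto
  have finU: "finite (\<Union>(A ` J))" if "J \<subseteq> I" for J
    using that fin finA by (meson finite_UN_I finite_subset subset_iff)
  show ?case
  proof (cases "I = {}")
    case False
    show ?thesis
    proof (cases "\<exists>J. J \<noteq> {} \<and> J \<subset> I \<and> card (\<Union>(A ` J)) = card J")
      case True
      then obtain J where J: "J \<noteq> {}" "J \<subset> I" and tight: "card (\<Union>(A ` J)) = card J"
        by blast
      have finJ: "finite J"
        using J fin finite_subset by auto
      have "\<exists>g. inj_on g J \<and> (\<forall>i\<in>J. g i \<in> A i)"
        using J fin finJ finA by (intro less.hyps hall psubset_card_mono) auto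
      then obtain g where g: "inj_on g J" "\<And>i. i \<in> J \<Longrightarrow> g i \<in> A i"
        by blast
      \<comment> \<open>Hall's condition for the remaining sets follows from the original one for
        \<open>K \<union> J\<close>, since tightness of \<open>J\<close> cancels the contribution of
        \<open>J\<close> exactly.\<close>
      define A' where "A' = (\<lambda>i. A i - \<Union>(A ` J))"
      have "\<exists>h. inj_on h (I - J) \<and> (\<forall>i\<in>I - J. h i \<in> A' i)"
      proof (rule less.hyps)
        show "card (I - J) < card I"
          using J fin by (intro psubset_card_mono) auto
        fix K assume K: "K \<subseteq> I - J"
        have "finite K"
          using K fin finite_subset by blast
        then have "card K + card J = card (K \<union> J)"
          using K finJ by (subst card_Un_disjoint) auto
        also have "\<dots> \<le> card (\<Union>(A ` (K \<union> J)))"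
          using K J by (intro hall) auto
        also have "\<Union>(A ` (K \<union> J)) = \<Union>(A' ` K) \<union> \<Union>(A ` J)"
          by (auto simp: A'_def)
        also have "card \<dots> \<le> card (\<Union>(A' ` K)) + card (\<Union>(A ` J))"
          by (rule card_Un_le)
        finally show "card K \<le> card (\<Union>(A' ` K))"
          using tight by simp
      qed (use fin finA in \<open>auto simp: A'_def\<close>)
      then obtain h where h: "inj_on h (I - J)" "\<And>i. i \<in> I - J \<Longrightarrow> h i \<in> A' i"
        by blast
      define f where "f i = (if i \<in> J then g i else h i)" for i
      have gh: "g i \<noteq> h k" if "i \<in> J" "k \<in> I - J" for i k
        using g(2)[OF that(1)] h(2)[OF that(2)] that(1) by (auto simp: A'_def)
      have "inj_on f I"
        using g(1) h(1) gh unfolding inj_on_def f_def by (metis DiffI)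
      moreover have "\<forall>i\<in>I. f i \<in> A i"
        using g(2) h(2) by (auto simp: f_def A'_def)
      ultimately show ?thesis
        by blast
    next
      case nontight: False
      obtain i where i: "i \<in> I"
        using False by blast
      have "card {i} \<le> card (A i)"
        using hall[of "{i}"] i by simp
      then obtain x where x: "x \<in> A i"
        by fastforce
      have "\<exists>h. inj_on h (I - {i}) \<and> (\<forall>k\<in>I - {i}. h k \<in> A k - {x})"
      proof (rule less.hyps)
        show "card (I - {i}) < card I"
          using i fin by (intro psubset_card_mono) auto
        fix K assume K: "K \<subseteq> I - {i}"
        show "card K \<le> card (\<Union>k\<in>K. A k - {x})"
        proof (cases "K = {}")
          case False
          \<comment> \<open>\<open>K\<close> omits \<open>i\<close>, so it is a proper subfamily;
            its strict surplus absorbs the loss of \<open>x\<close>.\<close>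
          have "K \<subset> I"
            using K i by auto
          then have "card K < card (\<Union>(A ` K))"
            using nontight False hall[of K] by (metis le_neq_implies_less psubset_imp_subset)
          moreover have "(\<Union>k\<in>K. A k - {x}) = \<Union>(A ` K) - {x}"
            by auto
          ultimately show ?thesis
            using finU[of K] \<open>K \<subset> I\<close> by (auto simp: card_Diff_singleton_if)
        qed simp
      qed (use fin finA in auto)
      then obtain h where h: "inj_on h (I - {i})" "\<And>k. k \<in> I - {i} \<Longrightarrow> h k \<in> A k - {x}"
        by blast
      have "inj_on (h(i := x)) I"
        using h unfolding inj_on_def by (auto simp: fun_upd_def)
      moreover have "\<forall>k\<in>I. (h(i := x)) k \<in> A k"
        using h(2) x by auto
      ultimately show ?thesis
        by blast
    qed
  qed simp
qed

text \<open>Double counting gives Hall's condition: \<open>r * card J\<close> edges leave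
  \<open>J\<close>, and each neighbour receives at most \<open>r\<close> of them. An injective
  choice on the finite set \<open>S\<close> is then onto.\<close>

lemma regular_relation_matching:
  fixes N :: "'a \<Rightarrow> 'a set"
  assumes "finite S" and N: "\<And>i. i \<in> S \<Longrightarrow> N i \<subseteq> S"
    and out: "\<And>i. i \<in> S \<Longrightarrow> card (N i) = r" and inc: "\<And>j. j \<in> S \<Longrightarrow> card {i\<in>S. j \<in> N i} = r"
    and "r > 0"
  obtains \<rho> where "\<rho> permutes S" "\<And>i. i \<in> S \<Longrightarrow> \<rho> i \<in> N i"
proof -
  have finN: "finite (N i)" if "i \<in> S" for i
    using N[OF that] \<open>finite S\<close> finite_subset by blast
  have "\<exists>f. inj_on f S \<and> (\<forall>i\<in>S. f i \<in> N i)"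
  proof (rule Hall_marriage)
    fix J assume J: "J \<subseteq> S"
    define U where "U = \<Union>(N ` J)"
    have US: "U \<subseteq> S"
      using J N by (auto simp: U_def)
    have fin: "finite J" "finite U"
      using J US \<open>finite S\<close> finite_subset by auto
    have "r * card J = (\<Sum>i\<in>J. card {j\<in>U. j \<in> N i})"
    proof -
      have "{j\<in>U. j \<in> N i} = N i" if "i \<in> J" for i
        using that by (auto simp: U_def)
      then show ?thesis
        using J out by (simp add: subset_iff)
    qed
    also have "\<dots> = (\<Sum>j\<in>U. card {i\<in>J. j \<in> N i})"
      using fin by (intro sum_multicount_gen) auto
    also have "\<dots> \<le> (\<Sum>j\<in>U. r)"
    proof (rule sum_mono)
      fix j assume "j \<in> U"
      then have "card {i\<in>J. j \<in> N i} \<le> card {i\<in>S. j \<in> N i}"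
        using J \<open>finite S\<close> by (intro card_mono) auto
      then show "card {i\<in>J. j \<in> N i} \<le> r"
        using inc US \<open>j \<in> U\<close> by auto
    qed
    finally show "card J \<le> card (\<Union>(N ` J))"
      using \<open>r > 0\<close> by (simp add: U_def mult.commute)
  qed (use \<open>finite S\<close> finN in auto)
  then obtain f where f: "inj_on f S" "\<And>i. i \<in> S \<Longrightarrow> f i \<in> N i"
    by blast
  then have "f ` S = S"
    using N \<open>finite S\<close> by (intro endo_inj_surj) auto
  then have "(\<lambda>i. if i \<in> S then f i else i) permutes S"
    using f(1) by (intro bij_imp_permutes) (auto simp: bij_betw_def inj_on_def)
  then show thesis
    using that f(2) by auto
qed

text \<open>Induction on the degree: deleting a perfect matching from a regular relation lowers
  every in- and out-degree by one. The unique-existence clause says that the members of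
  \<open>R\<close> partition the edges.\<close>

lemma regular_relation_decomposition:
  fixes N :: "'a \<Rightarrow> 'a set"
  assumes "finite S" and "\<And>i. i \<in> S \<Longrightarrow> N i \<subseteq> S"
    and "\<And>i. i \<in> S \<Longrightarrow> card (N i) = r" and "\<And>j. j \<in> S \<Longrightarrow> card {i\<in>S. j \<in> N i} = r"
  shows "\<exists>R. (\<forall>\<rho>\<in>R. \<rho> permutes S \<and> (\<forall>i\<in>S. \<rho> i \<in> N i)) \<and>
    (\<forall>i\<in>S. \<forall>j\<in>N i. \<exists>!\<rho>. \<rho> \<in> R \<and> \<rho> i = j)"
  using assms
proof (induction r arbitrary: N)
  case 0
  then have "N i = {}" if "i \<in> S" for i
    using that by (metis card_eq_0_iff finite_subset)
  then show ?case
    by (intro exI[of _ "{}"]) auto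
next
  case (Suc r)
  obtain \<rho> where \<rho>: "\<rho> permutes S" and \<rho>N: "\<And>i. i \<in> S \<Longrightarrow> \<rho> i \<in> N i"
    using regular_relation_matching[OF Suc.prems] by auto
  have finN: "finite (N i)" if "i \<in> S" for i
    using Suc.prems that finite_subset by metis
  define N' where "N' i = N i - {\<rho> i}" for i
  have "\<exists>R. (\<forall>\<rho>\<in>R. \<rho> permutes S \<and> (\<forall>i\<in>S. \<rho> i \<in> N' i)) \<and>
    (\<forall>i\<in>S. \<forall>j\<in>N' i. \<exists>!\<rho>. \<rho> \<in> R \<and> \<rho> i = j)"
  proof (rule Suc.IH)
    fix i assume i: "i \<in> S"
    show "N' i \<subseteq> S"
      using Suc.prems(2)[OF i] by (auto simp: N'_def)
    show "card (N' i) = r"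
      using Suc.prems(3)[OF i] \<rho>N[OF i] finN[OF i] by (simp add: N'_def)
    have "{k\<in>S. i \<in> N' k} = {k\<in>S. i \<in> N k} - {inv \<rho> i}"
      using permutes_inverses[OF \<rho>] by (auto simp: N'_def)
    moreover have "inv \<rho> i \<in> {k\<in>S. i \<in> N k}"
      using i \<rho> \<rho>N by (metis (mono_tags, lifting) mem_Collect_eq permutes_in_image
          permutes_inv permutes_inverses(1))
    ultimately show "card {k\<in>S. i \<in> N' k} = r"
      using Suc.prems(4)[OF i] \<open>finite S\<close> by simp
  qed fact
  then obtain R where R: "\<And>\<tau>. \<tau> \<in> R \<Longrightarrow> \<tau> permutes S" "\<And>\<tau> i. \<tau> \<in> R \<Longrightarrow> i \<in> S \<Longrightarrow> \<tau> i \<in> N' i"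
    and ex1: "\<And>i j. i \<in> S \<Longrightarrow> j \<in> N' i \<Longrightarrow> \<exists>!\<tau>. \<tau> \<in> R \<and> \<tau> i = j"
    by metis
  have "\<exists>!\<tau>. \<tau> \<in> insert \<rho> R \<and> \<tau> i = j" if "i \<in> S" "j \<in> N i" for i j
  proof (cases "j = \<rho> i")
    case True
    then show ?thesis
      using R(2) that by (intro ex1I[of _ \<rho>]) (auto simp: N'_def)
  next
    case False
    then have "j \<in> N' i"
      using that by (simp add: N'_def)
    with ex1[OF that(1)] show ?thesis
      using False by (metis insert_iff)
  qed
  moreover have "\<forall>\<tau>\<in>insert \<rho> R. \<tau> permutes S \<and> (\<forall>i\<in>S. \<tau> i \<in> N i)"
    using R \<rho> \<rho>N by (auto simp: N'_def)
  ultimately show ?case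
    by (intro exI[of _ "insert \<rho> R"]) blast
qed

section \<open>Functions invariant under switches\<close>

lemma disjoint_permutes_commute:
  assumes "a permutes A" "b permutes B" "A \<inter> B = {}"
  shows "a \<circ> b = b \<circ> a"
proof
  fix x
  consider "x \<in> A" | "x \<in> B" | "x \<notin> A" "x \<notin> B"
    by blast
  then show "(a \<circ> b) x = (b \<circ> a) x"
  proof cases
    case 1
    then have "x \<notin> B" "a x \<notin> B"
      using assms(3) permutes_in_image[OF assms(1), of x] by auto
    then show ?thesis
      using assms by (simp add: permutes_not_in)
  next
    case 2
    then have "x \<notin> A" "b x \<notin> A"
      using assms(3) permutes_in_image[OF assms(2), of x] by auto
    then show ?thesis
      using assms by (simp add: permutes_not_in)
  next
    case 3
    then show ?thesis
      using assms by (simp add: permutes_not_in)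
  qed
qed

text \<open>The complements of \<open>A\<close> and of its image have equal size, so any bijection
  between them completes \<open>g\<close>.\<close>

lemma permutation_extending_inj:
  assumes "finite S" "A \<subseteq> S" "inj_on g A" "g ` A \<subseteq> S"
  obtains \<sigma> where "\<sigma> permutes S" "\<And>i. i \<in> A \<Longrightarrow> \<sigma> i = g i"
proof -
  have fin: "finite A" "finite (g ` A)"
    using assms finite_subset by auto
  have "card (S - A) = card (S - g ` A)"
    using assms fin by (simp add: card_Diff_subset card_image)
  then obtain h where h: "bij_betw h (S - A) (S - g ` A)"
    using assms(1) by (meson finite_Diff finite_same_card_bij)
  define \<sigma> where "\<sigma> i = (if i \<in> A then g i else if i \<in> S then h i else i)" for i
  have 1: "bij_betw \<sigma> A (g ` A)"
    using assms(3) by (intro bij_betw_cong[THEN iffD2, OF _ inj_on_imp_bij_betw]) (auto simp: \<sigma>_def)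
  have 2: "bij_betw \<sigma> (S - A) (S - g ` A)"
    using h by (rule bij_betw_cong[THEN iffD2, rotated]) (auto simp: \<sigma>_def)
  have "bij_betw \<sigma> (A \<union> (S - A)) (g ` A \<union> (S - g ` A))"
    using 1 2 by (rule bij_betw_combine) auto
  moreover have "A \<union> (S - A) = S" "g ` A \<union> (S - g ` A) = S"
    using assms by auto
  ultimately have "\<sigma> permutes S"
    using assms(2) by (intro bij_imp_permutes) (auto simp: \<sigma>_def)
  then show thesis
    using that by (simp add: \<sigma>_def)
qed

text \<open>A single cycle through all of \<open>C\<close> works, because its length is at least 3.
  It is the shift modulo \<open>m\<close>, transported along an enumeration of
  \<open>C\<close>.\<close>

lemma derangement_with_derangement_square:
  assumes "finite C" "3 \<le> card C"
  obtains c where "c permutes C" "\<And>i. i \<in> C \<Longrightarrow> c i \<noteq> i" "\<And>i. i \<in> C \<Longrightarrow> c (c i) \<noteq> i"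
proof -
  define m where "m = card C"
  obtain h where h: "bij_betw h C {0..<m}"
    using assms(1) ex_bij_betw_finite_nat m_def by blast
  define s where "s k = (k + 1) mod m" for k
  define k where "k = inv_into C h"
  have k: "bij_betw k {0..<m} C"
    using h by (simp add: k_def bij_betw_inv_into)
  have hk: "h (k x) = x" if "x < m" for x
    using h that by (simp add: k_def bij_betw_inv_into_right)
  have kh: "k (h i) = i" if "i \<in> C" for i
    using h that by (simp add: k_def bij_betw_inv_into_left)
  have m: "m \<ge> 3"
    using assms by (simp add: m_def)
  have sm: "s x < m" for x
    using m by (simp add: s_def)
  have hm: "h i < m" if "i \<in> C" for i
    using h that bij_betwE by fastforce
  have s_neq: "s x \<noteq> x" "s (s x) \<noteq> x" if "x < m" for x
  proof -
    show "s x \<noteq> x"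
      using that m by (cases "x + 1 = m") (auto simp: s_def)
    have "s x = (if x + 1 = m then 0 else x + 1)" if "x < m" for x
      using that by (auto simp: s_def)
    then show "s (s x) \<noteq> x"
      using that m sm[of x] by (auto split: if_splits)
  qed
  have "inj_on s {0..<m}"
  proof (rule inj_onI)
    fix x y assume "x \<in> {0..<m}" "y \<in> {0..<m}" "s x = s y"
    then show "x = y"
      by (cases "x + 1 = m"; cases "y + 1 = m") (auto simp: s_def)
  qed
  define c where "c i = (if i \<in> C then k (s (h i)) else i)" for i
  have "inj_on c C"
  proof (rule inj_onI)
    fix i j assume ij: "i \<in> C" "j \<in> C" "c i = c j"
    then have "s (h i) = s (h j)"
      using hk sm by (metis c_def)
    then have "h i = h j"
      using \<open>inj_on s {0..<m}\<close> hm ij by (auto simp: inj_on_def)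
    then show "i = j"
      using kh ij by metis
  qed
  moreover have cC: "c i \<in> C" if "i \<in> C" for i
    using k sm bij_betwE that by (fastforce simp: c_def)
  moreover have "c ` C = C"
    using assms(1) cC \<open>inj_on c C\<close> by (intro endo_inj_surj) auto
  ultimately have "c permutes C"
    by (intro bij_imp_permutes) (auto simp: bij_betw_def c_def)
  moreover have "c i \<noteq> i" "c (c i) \<noteq> i" if i: "i \<in> C" for i
  proof -
    have hc: "h (c j) = s (h j)" if "j \<in> C" for j
      using that hk sm by (simp add: c_def)
    show "c i \<noteq> i" "c (c i) \<noteq> i"
      using s_neq[OF hm[OF i]] hc[OF i] hc[OF cC[OF i]] by metis+
  qed
  ultimately show thesis
    using that by blast
qed

text \<open>In \<open>switch\<close>, \<open>\<sigma>\<close> and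
  \<open>\<sigma> \<circ> a \<circ> b\<close> differ at every point of \<open>S\<close>, while
  \<open>\<sigma> \<circ> a\<close> and \<open>\<sigma> \<circ> b\<close> take the same two values
  there: a pair of disjoint permutation matrices is exchanged for another with the same support. The
  bound 7 leaves three points beside two disjoint transpositions; in an ordered field
  \<open>x = - x\<close> forces \<open>x = 0\<close>.\<close>

locale switch_invariant =
  fixes S :: "'a set" and f :: "('a \<Rightarrow> 'a) \<Rightarrow> 'b :: linordered_field"
  assumes finite_S: "finite S" and card_S: "7 \<le> card S"
    and switch: "\<lbrakk>\<sigma> permutes S; a permutes A; b permutes B; A \<inter> B = {}; A \<union> B = S;
      \<And>i. i \<in> A \<Longrightarrow> a i \<noteq> i; \<And>i. i \<in> B \<Longrightarrow> b i \<noteq> i\<rbrakk>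
      \<Longrightarrow> f \<sigma> + f (\<sigma> \<circ> a \<circ> b) = f (\<sigma> \<circ> a) + f (\<sigma> \<circ> b)"
begin

abbreviation tr :: "'a \<Rightarrow> 'a \<Rightarrow> 'a \<Rightarrow> 'a" where
  "tr \<equiv> Transposition.transpose"

section \<open>Mixed differences and locality of transposition increments\<close>

definition mixed_diff :: "('a \<Rightarrow> 'a) \<Rightarrow> ('a \<Rightarrow> 'a) \<Rightarrow> ('a \<Rightarrow> 'a) \<Rightarrow> 'b" where
  "mixed_diff a b \<sigma> = f (\<sigma> \<circ> a \<circ> b) - f (\<sigma> \<circ> a) - f (\<sigma> \<circ> b) + f \<sigma>"

text \<open>The product of \<open>a\<close>, \<open>b\<close>, \<open>c\<close> moves every point of
  \<open>S\<close> and splits into two disjoint factors in three ways. Adding the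
  \<open>switch\<close> equations for \<open>a\<close> against \<open>b \<circ> c\<close> and for
  \<open>b\<close> against \<open>a \<circ> c\<close>, and subtracting the one for \<open>c\<close>
  against \<open>a \<circ> b\<close>, gives the claim.\<close>

lemma mixed_diff_derangement:
  assumes \<sigma>: "\<sigma> permutes S"
    and a: "a permutes A" "\<And>i. i \<in> A \<Longrightarrow> a i \<noteq> i"
    and b: "b permutes B" "\<And>i. i \<in> B \<Longrightarrow> b i \<noteq> i"
    and c: "c permutes C" "\<And>i. i \<in> C \<Longrightarrow> c i \<noteq> i"
    and disj: "A \<inter> B = {}" "A \<inter> C = {}" "B \<inter> C = {}" and un: "A \<union> B \<union> C = S"
  shows "mixed_diff a b (\<sigma> \<circ> c) = - mixed_diff a b \<sigma>"
proof -
  have union: "p \<circ> q permutes (P \<union> Q) \<and> (\<forall>i\<in>P \<union> Q. (p \<circ> q) i \<noteq> i)"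
    if pq: "p permutes P" "q permutes Q" "P \<inter> Q = {}" "\<And>i. i \<in> P \<Longrightarrow> p i \<noteq> i" "\<And>i. i \<in> Q \<Longrightarrow> q i \<noteq> i"
    for p q P Q
  proof (intro conjI ballI)
    show "p \<circ> q permutes (P \<union> Q)"
      using pq by (intro permutes_compose) (auto intro: permutes_subset)
    fix i assume "i \<in> P \<union> Q"
    then consider "i \<in> P" "i \<notin> Q" | "i \<in> Q" "q i \<notin> P"
      using pq(3) permutes_in_image[OF pq(2), of i] by blast
    then show "(p \<circ> q) i \<noteq> i"
      using pq by cases (auto simp: permutes_not_in)
  qed
  have 1: "f \<sigma> + f (\<sigma> \<circ> a \<circ> (b \<circ> c)) = f (\<sigma> \<circ> a) + f (\<sigma> \<circ> (b \<circ> c))"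
    using union[OF b(1) c(1) disj(3) b(2) c(2)] a disj un
    by (intro switch[OF \<sigma>, of a A "b \<circ> c" "B \<union> C"]) auto
  have 2: "f \<sigma> + f (\<sigma> \<circ> b \<circ> (a \<circ> c)) = f (\<sigma> \<circ> b) + f (\<sigma> \<circ> (a \<circ> c))"
    using union[OF a(1) c(1) disj(2) a(2) c(2)] b disj un
    by (intro switch[OF \<sigma>, of b B "a \<circ> c" "A \<union> C"]) auto
  have 3: "f \<sigma> + f (\<sigma> \<circ> c \<circ> (a \<circ> b)) = f (\<sigma> \<circ> c) + f (\<sigma> \<circ> (a \<circ> b))"
    using union[OF a(1) b(1) disj(1) a(2) b(2)] c disj un
    by (intro switch[OF \<sigma>, of c C "a \<circ> b" "A \<union> B"]) auto
  have "b (a x) = a (b x)" "c (a x) = a (c x)" "c (b x) = b (c x)" for x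
    using disjoint_permutes_commute[OF a(1) b(1) disj(1)]
      disjoint_permutes_commute[OF a(1) c(1) disj(2)]
      disjoint_permutes_commute[OF b(1) c(1) disj(3)] by (simp_all add: fun_eq_iff)
  then have "\<sigma> \<circ> b \<circ> (a \<circ> c) = \<sigma> \<circ> a \<circ> (b \<circ> c)" "\<sigma> \<circ> c \<circ> (a \<circ> b) = \<sigma> \<circ> a \<circ> (b \<circ> c)"
    "\<sigma> \<circ> c \<circ> a \<circ> b = \<sigma> \<circ> a \<circ> (b \<circ> c)" "\<sigma> \<circ> c \<circ> a = \<sigma> \<circ> (a \<circ> c)" "\<sigma> \<circ> c \<circ> b = \<sigma> \<circ> (b \<circ> c)"
    "\<sigma> \<circ> (a \<circ> b) = \<sigma> \<circ> a \<circ> b"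
    by (simp_all add: fun_eq_iff)
  with 1 2 3 show ?thesis
    unfolding mixed_diff_def by simp
qed

text \<open>The claim is that the mixed difference of the two transpositions vanishes. The four
  points involved leave at least three, which carry a derangement \<open>c\<close> whose square is a
  derangement too.\<close>

lemma commuting_transpositions:
  assumes \<sigma>: "\<sigma> permutes S" and S: "i \<in> S" "j \<in> S" "k \<in> S" "l \<in> S"
    and d: "i \<noteq> j" "k \<noteq> l" "{i, j} \<inter> {k, l} = {}"
  shows "f (\<sigma> \<circ> tr k l \<circ> tr i j) - f (\<sigma> \<circ> tr k l) = f (\<sigma> \<circ> tr i j) - f \<sigma>"
proof -
  define C where "C = S - {i, j, k, l}"
  have "card {i, j, k, l} = 4"
    using d by auto
  then have "3 \<le> card C"
    using S card_S by (simp add: C_def card_Diff_subset)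
  then obtain c where c: "c permutes C" "\<And>x. x \<in> C \<Longrightarrow> c x \<noteq> x" "\<And>x. x \<in> C \<Longrightarrow> c (c x) \<noteq> x"
    using derangement_with_derangement_square[of C] finite_S C_def by (metis finite_Diff)
  have tr: "tr x y permutes {x, y}" "\<And>z. z \<in> {x, y} \<Longrightarrow> tr x y z \<noteq> z" if "x \<noteq> y" for x y :: 'a
    using that by (auto intro: permutes_swap_id)
  have neg: "mixed_diff (tr k l) (tr i j) (\<tau> \<circ> e) = - mixed_diff (tr k l) (tr i j) \<tau>"
    if "\<tau> permutes S" "e permutes C" "\<And>x. x \<in> C \<Longrightarrow> e x \<noteq> x" for \<tau> e
    using that d S tr[of k l] tr[of i j]
    by (intro mixed_diff_derangement[of _ _ "{k, l}" _ "{i, j}" _ C]) (auto simp: C_def)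
  have cS: "c permutes S"
    using c(1) by (rule permutes_subset) (auto simp: C_def)
  have "c \<circ> c permutes C"
    using c(1) by (simp add: permutes_compose)
  \<comment> \<open>Moving by \<open>c \<circ> c\<close> in one step changes the sign once; moving
    by \<open>c\<close> twice, as in the next fact, changes it twice. So the mixed difference equals
    its own negative.\<close>
  then have "mixed_diff (tr k l) (tr i j) (\<sigma> \<circ> (c \<circ> c)) = - mixed_diff (tr k l) (tr i j) \<sigma>"
    using c \<sigma> by (intro neg) auto
  moreover have "mixed_diff (tr k l) (tr i j) (\<sigma> \<circ> c \<circ> c) = mixed_diff (tr k l) (tr i j) \<sigma>"
    using neg[of "\<sigma> \<circ> c" c] neg[of \<sigma> c] c \<sigma> cS permutes_compose by fastforce
  ultimately have "mixed_diff (tr k l) (tr i j) \<sigma> = 0"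
    by (simp add: comp_assoc)
  then show ?thesis
    by (simp add: mixed_diff_def algebra_simps)
qed

text \<open>\<open>\<tau>\<close> is \<open>\<sigma>\<close> followed on the right by a permutation
  fixing \<open>i\<close> and \<open>j\<close>, that is, by a product of transpositions disjoint
  from \<open>{i, j}\<close>, and each of these leaves the increment unchanged.\<close>

lemma transposition_increment_local:
  assumes ij: "i \<in> S" "j \<in> S" "i \<noteq> j" and \<sigma>: "\<sigma> permutes S" and \<tau>: "\<tau> permutes S"
    and eq: "\<sigma> i = \<tau> i" "\<sigma> j = \<tau> j"
  shows "f (\<tau> \<circ> tr i j) - f \<tau> = f (\<sigma> \<circ> tr i j) - f \<sigma>"
proof -
  \<comment> \<open>The quantifier over \<open>\<sigma>\<close> stays inside the induction, because
    the leading transposition of \<open>p\<close> is absorbed into \<open>\<sigma>\<close>.\<close>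
  have shift: "\<forall>\<sigma>. \<sigma> permutes S \<longrightarrow> f (\<sigma> \<circ> p \<circ> tr i j) - f (\<sigma> \<circ> p) = f (\<sigma> \<circ> tr i j) - f \<sigma>"
    if "p permutes S - {i, j}" for p
    using that finite_Diff[OF finite_S]
  proof (induction p rule: permutes_induct)
    case (swap k l p)
    show ?case
    proof (intro allI impI)
      fix \<sigma> assume "\<sigma> permutes S"
      then have "\<sigma> \<circ> tr k l permutes S"
        using swap by (intro permutes_compose permutes_swap_id) auto
      then have "f (\<sigma> \<circ> tr k l \<circ> p \<circ> tr i j) - f (\<sigma> \<circ> tr k l \<circ> p)
          = f (\<sigma> \<circ> tr k l \<circ> tr i j) - f (\<sigma> \<circ> tr k l)"
        using swap by blast
      also have "\<dots> = f (\<sigma> \<circ> tr i j) - f \<sigma>"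
        using swap ij \<open>\<sigma> permutes S\<close> by (intro commuting_transpositions) auto
      finally show "f (\<sigma> \<circ> (tr k l \<circ> p) \<circ> tr i j) - f (\<sigma> \<circ> (tr k l \<circ> p)) = f (\<sigma> \<circ> tr i j) - f \<sigma>"
        by (simp add: comp_assoc)
    qed
  qed simp
  have "inv \<sigma> \<circ> \<tau> permutes S"
    using \<sigma> \<tau> by (simp add: permutes_compose permutes_inv)
  moreover have "(inv \<sigma> \<circ> \<tau>) i = i" "(inv \<sigma> \<circ> \<tau>) j = j"
    using eq \<sigma> by (auto simp: permutes_inv_eq)
  ultimately have "inv \<sigma> \<circ> \<tau> permutes S - {i, j}"
    by (elim permutes_superset) auto
  moreover have "\<sigma> \<circ> (inv \<sigma> \<circ> \<tau>) = \<tau>"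
    using \<sigma> by (simp add: fun_eq_iff permutes_inverses)
  ultimately show ?thesis
    using shift \<sigma> by metis
qed

text \<open>The witness below is irrelevant by the preceding lemma.\<close>

definition incr :: "'a \<Rightarrow> 'a \<Rightarrow> 'a \<Rightarrow> 'a \<Rightarrow> 'b" where
  "incr i j x y = (let \<sigma> = SOME \<sigma>. \<sigma> permutes S \<and> \<sigma> i = x \<and> \<sigma> j = y in f (\<sigma> \<circ> tr i j) - f \<sigma>)"

lemma incr_eq:
  assumes "i \<in> S" "j \<in> S" "i \<noteq> j" "\<sigma> permutes S" "\<sigma> i = x" "\<sigma> j = y"
  shows "incr i j x y = f (\<sigma> \<circ> tr i j) - f \<sigma>"
proof -
  define \<tau> where "\<tau> = (SOME \<sigma>. \<sigma> permutes S \<and> \<sigma> i = x \<and> \<sigma> j = y)"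
  have "\<tau> permutes S \<and> \<tau> i = x \<and> \<tau> j = y"
    unfolding \<tau>_def by (rule someI[of _ \<sigma>]) (use assms in auto)
  then show ?thesis
    using transposition_increment_local[of i j \<sigma> \<tau>] assms by (simp add: incr_def flip: \<tau>_def)
qed

section \<open>The cocycle property of the increments\<close>

lemma permutation_3_points:
  assumes "i \<in> S" "j \<in> S" "k \<in> S" "x \<in> S" "y \<in> S" "z \<in> S"
    "i \<noteq> j" "i \<noteq> k" "j \<noteq> k" "x \<noteq> y" "x \<noteq> z" "y \<noteq> z"
  obtains \<sigma> where "\<sigma> permutes S" "\<sigma> i = x" "\<sigma> j = y" "\<sigma> k = z"
proof -
  define g where "g a = (if a = i then x else if a = j then y else z)" for a
  obtain \<sigma> where "\<sigma> permutes S" "\<And>a. a \<in> {i, j, k} \<Longrightarrow> \<sigma> a = g a"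
    using permutation_extending_inj[OF finite_S, of "{i, j, k}" g] assms
    by (auto simp: g_def inj_on_def)
  then show thesis
    using that assms by (auto simp: g_def)
qed

lemma exists_other: "\<exists>l\<in>S. l \<notin> {i, j, k}"
proof -
  have "card {i, j, k} \<le> 3"
    by (simp add: card_insert_if)
  then show ?thesis
    using card_mono[of "{i, j, k}" S] card_S by fastforce
qed

text \<open>Applying the same transposition a second time leads from
  \<open>\<sigma> \<circ> tr i j\<close> back to \<open>\<sigma>\<close>, and at
  \<open>\<sigma> \<circ> tr i j\<close> the two values are interchanged.\<close>

lemma incr_flip:
  assumes "i \<in> S" "j \<in> S" "i \<noteq> j" "x \<in> S" "y \<in> S" "x \<noteq> y"
  shows "incr i j y x = - incr i j x y" "incr j i x y = - incr i j x y"
proof -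
  obtain k where k: "k \<in> S" "k \<notin> {i, j}"
    using exists_other[of i j j] by auto
  obtain z where z: "z \<in> S" "z \<notin> {x, y}"
    using exists_other[of x y y] by auto
  obtain \<sigma> where \<sigma>: "\<sigma> permutes S" "\<sigma> i = x" "\<sigma> j = y"
    using permutation_3_points[of i j k x y z] assms k z by auto
  have \<tau>: "\<sigma> \<circ> tr i j permutes S"
    using assms \<sigma> by (intro permutes_compose permutes_swap_id) auto
  have "incr i j x y = f (\<sigma> \<circ> tr i j) - f \<sigma>"
    using assms \<sigma> by (intro incr_eq) auto
  moreover have "incr i j y x = f (\<sigma> \<circ> tr i j \<circ> tr i j) - f (\<sigma> \<circ> tr i j)"
    using assms \<sigma> \<tau> by (intro incr_eq) auto
  moreover have "incr j i x y = f (\<sigma> \<circ> tr i j \<circ> tr j i) - f (\<sigma> \<circ> tr i j)"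
    using assms \<sigma> \<tau> by (intro incr_eq) auto
  ultimately show "incr i j y x = - incr i j x y" "incr j i x y = - incr i j x y"
    by (simp_all add: comp_assoc transpose_commute)
qed

text \<open>Permuting the values at \<open>i\<close>, \<open>j\<close>, \<open>k\<close> gives six
  permutations: \<open>\<sigma>\<close>, its rotations \<open>\<alpha>\<close> and
  \<open>\<beta>\<close>, and three of opposite parity. Both \<open>tr i j\<close> and
  \<open>tr j k\<close> map the first three bijectively onto the last three, so both sides equal the
  sum of \<open>f\<close> over the last three minus that over the first three.\<close>

lemma incr_cycle_shift:
  assumes S: "i \<in> S" "j \<in> S" "k \<in> S" "x \<in> S" "y \<in> S" "z \<in> S"
    and d: "i \<noteq> j" "i \<noteq> k" "j \<noteq> k" "x \<noteq> y" "x \<noteq> z" "y \<noteq> z"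
  shows "incr i j x y + incr i j y z + incr i j z x = incr j k x y + incr j k y z + incr j k z x"
proof -
  obtain \<sigma> where \<sigma>: "\<sigma> permutes S" "\<sigma> i = x" "\<sigma> j = y" "\<sigma> k = z"
    using permutation_3_points[OF assms] .
  define \<alpha> where "\<alpha> = \<sigma> \<circ> tr i j \<circ> tr j k"
  define \<beta> where "\<beta> = \<sigma> \<circ> tr j k \<circ> tr i j"
  have perm: "\<alpha> permutes S" "\<beta> permutes S"
    unfolding \<alpha>_def \<beta>_def using S \<sigma> by (auto intro!: permutes_compose permutes_swap_id)
  have \<alpha>: "\<alpha> i = y" "\<alpha> j = z" "\<alpha> k = x" and \<beta>: "\<beta> i = z" "\<beta> j = x" "\<beta> k = y"
    using d \<sigma> by (auto simp: \<alpha>_def \<beta>_def transpose_def)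
  have "\<alpha> \<circ> tr i j = \<beta> \<circ> tr j k"
    using d \<sigma> by (auto simp: \<alpha>_def \<beta>_def transpose_def fun_eq_iff)
  moreover have "\<alpha> \<circ> tr j k = \<sigma> \<circ> tr i j" "\<beta> \<circ> tr i j = \<sigma> \<circ> tr j k"
    by (simp_all add: \<alpha>_def \<beta>_def comp_assoc)
  moreover have "incr i j x y = f (\<sigma> \<circ> tr i j) - f \<sigma>" "incr j k y z = f (\<sigma> \<circ> tr j k) - f \<sigma>"
    "incr i j y z = f (\<alpha> \<circ> tr i j) - f \<alpha>" "incr j k z x = f (\<alpha> \<circ> tr j k) - f \<alpha>"
    "incr i j z x = f (\<beta> \<circ> tr i j) - f \<beta>" "incr j k x y = f (\<beta> \<circ> tr j k) - f \<beta>"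
    using S d \<sigma> perm \<alpha> \<beta> by (auto intro!: incr_eq)
  ultimately show ?thesis
    by simp
qed

text \<open>The cyclic sum is unchanged when the pair of positions is shifted, but changes sign when
  the pair is reversed.\<close>

lemma incr_cycle_zero:
  assumes S: "i \<in> S" "j \<in> S" "x \<in> S" "y \<in> S" "z \<in> S"
    and d: "i \<noteq> j" "x \<noteq> y" "x \<noteq> z" "y \<noteq> z"
  shows "incr i j x y + incr i j y z + incr i j z x = 0"
proof -
  obtain k where k: "k \<in> S" "k \<notin> {i, j}"
    using exists_other[of i j j] by auto
  obtain l where l: "l \<in> S" "l \<notin> {i, j, k}"
    using exists_other[of i j k] by auto
  define E where "E a b = incr a b x y + incr a b y z + incr a b z x" for a b
  have shift: "E a b = E b c" if "a \<in> S" "b \<in> S" "c \<in> S" "a \<noteq> b" "a \<noteq> c" "b \<noteq> c" for a b c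
    unfolding E_def using that assms by (intro incr_cycle_shift) auto
  \<comment> \<open>With three positions the shift only rotates pairs; the fourth position
    \<open>l\<close> lets the walk return to \<open>{i, j}\<close> in reversed order.\<close>
  have "E i j = E j k" "E j k = E k l" "E k l = E l j" "E l j = E j i"
    using k l S d by (auto intro!: shift)
  moreover have "E j i = - E i j"
    unfolding E_def using incr_flip(2)[of i j] assms by simp
  ultimately show ?thesis
    unfolding E_def by simp
qed

text \<open>The increments along \<open>tr r j\<close> have a potential \<open>u j\<close>.
  Correcting \<open>f\<close> by these potentials gives a function \<open>h\<close> invariant under
  all transpositions through \<open>r\<close>; they generate the symmetric group, so
  \<open>h\<close> is constant.\<close>

theorem switch_invariant_linear:
  shows "\<exists>M c. \<forall>\<sigma>. \<sigma> permutes S \<longrightarrow> f \<sigma> = (\<Sum>i\<in>S. M i (\<sigma> i)) + c"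
proof -
  obtain r where r: "r \<in> S"
    using card_S by fastforce
  \<comment> \<open>The point \<open>r\<close> serves both as base position and as the value at
    which each potential is normalized to 0.\<close>
  define u where "u j x = (if x = r then 0 else incr r j r x)" for j x
  have u: "incr r j x y = u j y - u j x"
    if "j \<in> S" "j \<noteq> r" "x \<in> S" "y \<in> S" "x \<noteq> y" for j x y
  proof (cases "x = r \<or> y = r")
    case True
    then show ?thesis
      using that r incr_flip(1)[of r j r x] by (auto simp: u_def)
  next
    case False
    have "incr r j x y + incr r j y r + incr r j r x = 0"
      using False that r by (intro incr_cycle_zero) auto
    moreover have "incr r j y r = - incr r j r y"
      using False that r by (intro incr_flip(1)) auto
    ultimately show ?thesis
      using False by (simp add: u_def algebra_simps)
  qed
  \<comment> \<open>Position \<open>r\<close> gets no term, so passing to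
    \<open>\<sigma> \<circ> tr r j\<close> changes just the \<open>j\<close> summand, by the
    negative of the increment of \<open>f\<close>.\<close>
  define h where "h \<sigma> = f \<sigma> + (\<Sum>j\<in>S - {r}. u j (\<sigma> j))" for \<sigma>
  have base: "h (\<sigma> \<circ> tr r j) = h \<sigma>" if \<sigma>: "\<sigma> permutes S" and j: "j \<in> S" for \<sigma> j
  proof (cases "j = r")
    case False
    have "\<sigma> r \<noteq> \<sigma> j"
      using False permutes_inj[OF \<sigma>] by (simp add: inj_eq)
    have sum_split: "(\<Sum>i\<in>S - {r}. u i (\<tau> i)) = u j (\<tau> j) + (\<Sum>i\<in>S - {r} - {j}. u i (\<tau> i))" for \<tau>
      using j False finite_S by (intro sum.remove) auto
    have "(\<Sum>i\<in>S - {r} - {j}. u i ((\<sigma> \<circ> tr r j) i)) = (\<Sum>i\<in>S - {r} - {j}. u i (\<sigma> i))"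
      by (intro sum.cong) (auto simp: transpose_def)
    moreover have "f (\<sigma> \<circ> tr r j) - f \<sigma> = u j (\<sigma> j) - u j (\<sigma> r)"
      using u[of j "\<sigma> r" "\<sigma> j"] incr_eq[of r j \<sigma>] \<open>\<sigma> r \<noteq> \<sigma> j\<close> False j r \<sigma>
      by (simp add: permutes_in_image)
    ultimately show ?thesis
      unfolding h_def sum_split by (simp add: algebra_simps)
  qed simp
  have tr_inv: "h (\<sigma> \<circ> tr i j) = h \<sigma>" if \<sigma>: "\<sigma> permutes S" and ij: "i \<in> S" "j \<in> S" for \<sigma> i j
  proof -
    consider "i = j" | "i = r" | "j = r" | "i \<noteq> j" "i \<noteq> r" "j \<noteq> r"
      by blast
    then show ?thesis
    proof cases
      case 4
      \<comment> \<open>Conjugation expresses an arbitrary transposition through those that move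
        \<open>r\<close>.\<close>
      have "tr i j = tr r i \<circ> tr r j \<circ> tr r i"
        using 4 by (auto simp: fun_eq_iff transpose_def)
      then have "\<sigma> \<circ> tr i j = \<sigma> \<circ> tr r i \<circ> tr r j \<circ> tr r i"
        by (simp add: comp_assoc)
      then show ?thesis
        using \<sigma> ij r by (simp add: base permutes_compose permutes_swap_id)
    qed (use base \<sigma> ij in \<open>auto simp: transpose_commute\<close>)
  qed
  have const: "h \<sigma> = h id" if "\<sigma> permutes S" for \<sigma>
    using finite_S that
  proof (induction \<sigma> rule: permutes_rev_induct)
    case (swap i j \<sigma>)
    then show ?case
      using tr_inv by metis
  qed simp
  have "f \<sigma> = (\<Sum>i\<in>S. (if i = r then 0 else - u i (\<sigma> i))) + h id" if "\<sigma> permutes S" for \<sigma>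
  proof -
    have "(\<Sum>i\<in>S. (if i = r then 0 else - u i (\<sigma> i))) = (\<Sum>i\<in>S - {r}. - u i (\<sigma> i))"
      using finite_S by (intro sum.mono_neutral_cong_right) auto
    then show ?thesis
      using const[OF that] by (simp add: h_def sum_negf algebra_simps)
  qed
  then show ?thesis
    by (intro exI[of _ "\<lambda>i x. if i = r then 0 else - u i x"] exI[of _ "h id"]) simp
qed

end

section \<open>Latin squares from decompositions\<close>

text \<open>The symbol permutations of a latin square with the symbol names forgotten: the
  permutation matrices of \<open>R\<close> sum to the all-ones matrix.\<close>

definition decomposes :: "nat \<Rightarrow> (nat \<Rightarrow> nat) set \<Rightarrow> bool" where
  "decomposes n R \<longleftrightarrow> R \<subseteq> Sym n \<and> (\<forall>i\<in>{1..n}. \<forall>j\<in>{1..n}. \<exists>!\<sigma>. \<sigma> \<in> R \<and> \<sigma> i = j)"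

abbreviation perm_sum :: "(nat \<Rightarrow> nat) set \<Rightarrow> ((nat \<Rightarrow> nat) \<Rightarrow>\<^sub>0 rat)" where
  "perm_sum R \<equiv> \<Sum>\<sigma>\<in>R. Poly_Mapping.single \<sigma> 1"

lemma finite_Sym: "finite (Sym n)"
  by (simp add: finite_permutations)

lemma decomposes_unique:
  assumes "decomposes n R" "\<sigma> \<in> R" "\<tau> \<in> R" "i \<in> {1..n}" "\<sigma> i = \<tau> i"
  shows "\<sigma> = \<tau>"
proof -
  have "\<sigma> i \<in> {1..n}"
    using assms unfolding decomposes_def by (metis mem_Collect_eq permutes_in_image subsetD)
  then show ?thesis
    using assms unfolding decomposes_def by metis
qed

text \<open>Naming each member of \<open>R\<close> by its value at 1 turns the decomposition into a
  latin square that is row-normalized automatically.\<close>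

lemma perm_sum_decomposition_in_latin_span:
  assumes n: "1 \<le> n" and R: "decomposes n R"
  shows "perm_sum R \<in> latin_span n"
proof -
  define P where "P i j = (THE \<sigma>. \<sigma> \<in> R \<and> \<sigma> i = j)" for i j
  have P: "P i j \<in> R" "P i j i = j" if "i \<in> {1..n}" "j \<in> {1..n}" for i j
    unfolding P_def using theI'[of "\<lambda>\<sigma>. \<sigma> \<in> R \<and> \<sigma> i = j"] R that by (auto simp: decomposes_def)
  have P_eq: "P i j = \<sigma>" if "\<sigma> \<in> R" "\<sigma> i = j" "i \<in> {1..n}" "j \<in> {1..n}" for \<sigma> i j
    using decomposes_unique[OF R P(1) that(1) that(3)] P(2) that by simp
  have perm: "P i j permutes {1..n}" if "i \<in> {1..n}" "j \<in> {1..n}" for i j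
    using P(1)[OF that] R by (auto simp: decomposes_def)
  have one: "1 \<in> {1..n}"
    using n by simp
  \<comment> \<open>\<open>P i j\<close> is the member of \<open>R\<close> through cell
    \<open>(i, j)\<close>, and its value at 1 is its symbol; the permutation of symbol
    \<open>s\<close> is thus \<open>P 1 s\<close>.\<close>
  define L where "L i j = P i j 1" for i j
  have L_mem: "L i j \<in> {1..n}" if "i \<in> {1..n}" "j \<in> {1..n}" for i j
    unfolding L_def using permutes_in_image[OF perm[OF that]] one by blast
  have L: "L i j = s \<longleftrightarrow> P 1 s i = j" if "i \<in> {1..n}" "j \<in> {1..n}" "s \<in> {1..n}" for i j s
  proof
    assume "L i j = s"
    then have "P 1 s = P i j"
      using that P[of i j] one by (intro P_eq) (auto simp: L_def)
    then show "P 1 s i = j"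
      using P(2) that by simp
  next
    assume "P 1 s i = j"
    then have "P i j = P 1 s"
      using that P[of 1 s] one by (intro P_eq) auto
    then show "L i j = s"
      using P(2) that one by (simp add: L_def)
  qed
  have latin: "latin_square n L"
    unfolding latin_square_def
  proof (intro conjI ballI)
    fix i s assume si: "i \<in> {1..n}" "s \<in> {1..n}"
    have mem: "P 1 s i \<in> {1..n}"
      using permutes_in_image[OF perm[OF one si(2)]] si by blast
    show "\<exists>!j. j \<in> {1..n} \<and> L i j = s"
    proof (rule ex1I)
      show "P 1 s i \<in> {1..n} \<and> L i (P 1 s i) = s"
        using mem L[OF si(1) mem si(2)] by blast
      fix j assume "j \<in> {1..n} \<and> L i j = s"
      then show "j = P 1 s i"
        using L[OF si(1) _ si(2), of j] by metis
    qed
  next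
    fix j s assume js: "j \<in> {1..n}" "s \<in> {1..n}"
    note p = perm[OF one js(2)]
    have mem: "inv (P 1 s) j \<in> {1..n}"
      using permutes_in_image[OF permutes_inv[OF p]] js by blast
    show "\<exists>!i. i \<in> {1..n} \<and> L i j = s"
    proof (rule ex1I)
      show "inv (P 1 s) j \<in> {1..n} \<and> L (inv (P 1 s) j) j = s"
        using mem L[OF mem js] permutes_inverses(1)[OF p] by blast
      fix i assume "i \<in> {1..n} \<and> L i j = s"
      then show "i = inv (P 1 s) j"
        using L[OF _ js, of i] permutes_inverses(2)[OF p] by metis
    qed
  qed (rule L_mem)
  have norm: "row_normalized n L"
    using P(2) one by (auto simp: row_normalized_def L_def)
  have "symbol_perms n L = R"
  proof (intro equalityI subsetI)
    fix \<sigma> assume "\<sigma> \<in> symbol_perms n L"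
    then obtain s where \<sigma>: "\<sigma> permutes {1..n}" and s: "s \<in> {1..n}"
      and eq: "\<And>i j. i \<in> {1..n} \<Longrightarrow> j \<in> {1..n} \<Longrightarrow> \<sigma> i = j \<longleftrightarrow> L i j = s"
      by (auto simp: symbol_perms_def)
    have "\<sigma> i = P 1 s i" for i
    proof (cases "i \<in> {1..n}")
      case True
      then show ?thesis
        using eq L s permutes_in_image[OF \<sigma>] by metis
    next
      case False
      then show ?thesis
        using \<sigma> perm[OF one s] by (simp add: permutes_not_in)
    qed
    then show "\<sigma> \<in> R"
      using P(1)[OF one s] by (metis ext)
  next
    fix \<sigma> assume \<sigma>: "\<sigma> \<in> R"
    then have "\<sigma> permutes {1..n}"
      using R by (auto simp: decomposes_def)
    then have s: "\<sigma> 1 \<in> {1..n}"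
      using permutes_in_image one by metis
    then have "P 1 (\<sigma> 1) = \<sigma>"
      using \<sigma> one by (intro P_eq) auto
    then have "\<sigma> i = j \<longleftrightarrow> L i j = \<sigma> 1" if "i \<in> {1..n}" "j \<in> {1..n}" for i j
      using L[OF that s] by metis
    then show "\<sigma> \<in> symbol_perms n L"
      unfolding symbol_perms_def using s \<open>\<sigma> permutes {1..n}\<close> by blast
  qed
  then have "latin_element n L = perm_sum R"
    by (simp add: latin_element_def)
  then show ?thesis
    using latin norm unfolding latin_span_def
    by (intro qvs.span_base CollectI exI[of _ L]) simp
qed

text \<open>The member through cell \<open>(i, j)\<close> is the permutation of the symbol
  \<open>L i j\<close>: uniqueness in rows makes it a function, uniqueness in columns makes it
  injective.\<close>

lemma symbol_perms_decomposes:
  assumes L: "latin_square n L"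
  shows "decomposes n (symbol_perms n L)"
  unfolding decomposes_def
proof (intro conjI ballI)
  show "symbol_perms n L \<subseteq> Sym n"
    by (auto simp: symbol_perms_def)
  fix i j assume ij: "i \<in> {1..n}" "j \<in> {1..n}"
  define s where "s = L i j"
  have s: "s \<in> {1..n}"
    using L ij by (auto simp: latin_square_def s_def)
  have col: "\<exists>!k. k \<in> {1..n} \<and> L i k = s" if "i \<in> {1..n}" for i
    using L s that by (auto simp: latin_square_def)
  have row: "\<exists>!k. k \<in> {1..n} \<and> L k j = s" if "j \<in> {1..n}" for j
    using L s that by (auto simp: latin_square_def)
  \<comment> \<open>Outside \<open>{1..n}\<close> it is the identity, as \<open>permutes\<close>
    requires; this also makes equality of functions provable pointwise.\<close>
  define \<sigma> where "\<sigma> k = (if k \<in> {1..n} then THE l. l \<in> {1..n} \<and> L k l = s else k)" for k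
  have \<sigma>: "\<sigma> k \<in> {1..n}" "L k (\<sigma> k) = s" if "k \<in> {1..n}" for k
    using theI'[OF col[OF that]] that by (auto simp: \<sigma>_def)
  have \<sigma>_iff: "\<sigma> k = l \<longleftrightarrow> L k l = s" if "k \<in> {1..n}" "l \<in> {1..n}" for k l
    using \<sigma>[OF that(1)] col[OF that(1)] that by blast
  have "inj_on \<sigma> {1..n}"
    using \<sigma> row by (intro inj_onI) metis
  moreover have "\<sigma> ` {1..n} = {1..n}"
    using \<sigma> \<open>inj_on \<sigma> {1..n}\<close> by (intro endo_inj_surj) auto
  ultimately have perm: "\<sigma> permutes {1..n}"
    by (intro bij_imp_permutes) (auto simp: bij_betw_def \<sigma>_def)
  show "\<exists>!\<tau>. \<tau> \<in> symbol_perms n L \<and> \<tau> i = j"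
  proof (rule ex1I[of _ \<sigma>])
    show "\<sigma> \<in> symbol_perms n L \<and> \<sigma> i = j"
      using perm \<sigma>_iff s ij by (auto simp: symbol_perms_def s_def)
    fix \<tau> assume \<tau>: "\<tau> \<in> symbol_perms n L \<and> \<tau> i = j"
    then obtain t where t: "\<tau> permutes {1..n}"
      "\<And>i j. i \<in> {1..n} \<Longrightarrow> j \<in> {1..n} \<Longrightarrow> \<tau> i = j \<longleftrightarrow> L i j = t"
      by (auto simp: symbol_perms_def)
    then have "t = s"
      using \<tau> ij by (metis s_def)
    have "\<tau> k = \<sigma> k" for k
    proof (cases "k \<in> {1..n}")
      case True
      then show ?thesis
        using t \<sigma>_iff \<open>t = s\<close> \<sigma> by metis
    next
      case False
      then show ?thesis
        using t perm by (simp add: permutes_not_in)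
    qed
    then show "\<tau> = \<sigma>"
      by (rule ext)
  qed
qed

text \<open>By Hall's theorem the complement of two disjoint permutation matrices splits into permutation
  matrices, so the two can be replaced by any pair with the same support within a latin square.\<close>

lemma switch_in_latin_span:
  assumes n: "2 \<le> n" and \<sigma>: "\<sigma> permutes {1..n}" and \<tau>: "\<tau> permutes {1..n}"
    and \<sigma>': "\<sigma>' permutes {1..n}" and \<tau>': "\<tau>' permutes {1..n}"
    and disj: "\<And>i. i \<in> {1..n} \<Longrightarrow> \<sigma> i \<noteq> \<tau> i"
    and eq: "\<And>i. i \<in> {1..n} \<Longrightarrow> {\<sigma>' i, \<tau>' i} = {\<sigma> i, \<tau> i}"
  shows "Poly_Mapping.single \<sigma> 1 + Poly_Mapping.single \<tau> 1
    - (Poly_Mapping.single \<sigma>' 1 + Poly_Mapping.single \<tau>' 1) \<in> latin_span n"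
proof -
  define N where "N i = {1..n} - {\<sigma> i, \<tau> i}" for i
  have card2: "card ({1..n} - {x, y}) = n - 2" if "x \<in> {1..n}" "y \<in> {1..n}" "x \<noteq> y" for x y
    using that by (simp add: card_Diff_subset)
  have "\<exists>R. (\<forall>\<rho>\<in>R. \<rho> permutes {1..n} \<and> (\<forall>i\<in>{1..n}. \<rho> i \<in> N i)) \<and>
    (\<forall>i\<in>{1..n}. \<forall>j\<in>N i. \<exists>!\<rho>. \<rho> \<in> R \<and> \<rho> i = j)"
  proof (rule regular_relation_decomposition)
    fix i assume i: "i \<in> {1..n}"
    show "card (N i) = n - 2"
      unfolding N_def using permutes_in_image[OF \<sigma>] permutes_in_image[OF \<tau>] disj i
      by (intro card2) blast+
    \<comment> \<open>Column \<open>i\<close> loses the rows \<open>inv \<sigma> i\<close> and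
      \<open>inv \<tau> i\<close>, which are distinct because \<open>\<sigma>\<close> and
      \<open>\<tau>\<close> agree nowhere.\<close>
    have "{k \<in> {1..n}. i \<in> N k} = {1..n} - {inv \<sigma> i, inv \<tau> i}"
      using i permutes_inverses[OF \<sigma>] permutes_inverses[OF \<tau>] by (auto simp: N_def)
    moreover have "inv \<sigma> i \<noteq> inv \<tau> i"
      using disj[of "inv \<sigma> i"] i permutes_in_image[OF permutes_inv[OF \<sigma>]]
        permutes_inverses[OF \<sigma>] permutes_inverses[OF \<tau>] by metis
    ultimately show "card {k \<in> {1..n}. i \<in> N k} = n - 2"
      using i permutes_in_image[OF permutes_inv[OF \<sigma>]] permutes_in_image[OF permutes_inv[OF \<tau>]]
        card2 by presburger
  qed (auto simp: N_def)
  then obtain R where R: "\<And>\<rho>. \<rho> \<in> R \<Longrightarrow> \<rho> permutes {1..n}"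
    and RN: "\<And>\<rho> i. \<rho> \<in> R \<Longrightarrow> i \<in> {1..n} \<Longrightarrow> \<rho> i \<in> N i"
    and ex1: "\<And>i j. i \<in> {1..n} \<Longrightarrow> j \<in> N i \<Longrightarrow> \<exists>!\<rho>. \<rho> \<in> R \<and> \<rho> i = j"
    by metis
  have "finite R"
    using R finite_subset[OF _ finite_Sym[of n], of R] by blast
  \<comment> \<open>One and the same \<open>R\<close> completes every pair with this support, so
    \<open>perm_sum R\<close> cancels in the difference of two completions.\<close>
  have pair: "Poly_Mapping.single \<alpha> 1 + Poly_Mapping.single \<beta> 1 + perm_sum R \<in> latin_span n"
    if \<alpha>: "\<alpha> permutes {1..n}" and \<beta>: "\<beta> permutes {1..n}"
      and ab: "\<And>i. i \<in> {1..n} \<Longrightarrow> {\<alpha> i, \<beta> i} = {\<sigma> i, \<tau> i}" for \<alpha> \<beta>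
  proof -
    have ab_neq: "\<alpha> i \<noteq> \<beta> i" if "i \<in> {1..n}" for i
      using ab[OF that] disj[OF that] by (metis doubleton_eq_iff insert_absorb2)
    have N: "N i = {1..n} - {\<alpha> i, \<beta> i}" if "i \<in> {1..n}" for i
      using ab[OF that] by (simp add: N_def)
    have "decomposes n (insert \<alpha> (insert \<beta> R))"
      unfolding decomposes_def
    proof (intro conjI ballI)
      fix i j assume ij: "i \<in> {1..n}" "j \<in> {1..n}"
      have R_ab: "\<rho> i \<noteq> \<alpha> i \<and> \<rho> i \<noteq> \<beta> i" if "\<rho> \<in> R" for \<rho>
        using RN[OF that ij(1)] N[OF ij(1)] by auto
      consider "j = \<alpha> i" | "j = \<beta> i" | "j \<in> N i"
        using N[OF ij(1)] ij by auto
      then show "\<exists>!\<rho>. \<rho> \<in> insert \<alpha> (insert \<beta> R) \<and> \<rho> i = j"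
      proof cases
        case 1
        then show ?thesis
          using R_ab ab_neq[OF ij(1)] by (intro ex1I[of _ \<alpha>]) auto
      next
        case 2
        then show ?thesis
          using R_ab ab_neq[OF ij(1)] by (intro ex1I[of _ \<beta>]) auto
      next
        case 3
        then have "j \<noteq> \<alpha> i" "j \<noteq> \<beta> i"
          using N[OF ij(1)] by auto
        with ex1[OF ij(1) 3] show ?thesis
          by (metis insert_iff)
      qed
    qed (use R \<alpha> \<beta> in auto)
    then have "perm_sum (insert \<alpha> (insert \<beta> R)) \<in> latin_span n"
      using n by (intro perm_sum_decomposition_in_latin_span) auto
    moreover have "\<alpha> \<noteq> \<beta>" "\<alpha> \<notin> R" "\<beta> \<notin> R"
      using ab_neq[of 1] RN[of _ 1] N[of 1] n by fastforce+
    ultimately show ?thesis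
      using \<open>finite R\<close> by (simp add: add.assoc)
  qed
  have "(Poly_Mapping.single \<sigma> 1 + Poly_Mapping.single \<tau> 1 + perm_sum R)
    - (Poly_Mapping.single \<sigma>' 1 + Poly_Mapping.single \<tau>' 1 + perm_sum R) \<in> latin_span n"
    using pair[OF \<sigma> \<tau>] pair[OF \<sigma>' \<tau>' eq] unfolding latin_span_def by (intro qvs.span_diff) auto
  then show ?thesis
    by (simp add: algebra_simps)
qed

text \<open>The complete relation is \<open>n\<close>-regular. A single decomposition suffices later
  to evaluate the constant \<open>K\<close> of a functional on the flat space.\<close>

lemma decomposition_exists: "\<exists>R. decomposes n R"
proof -
  have "\<exists>R. (\<forall>\<rho>\<in>R. \<rho> permutes {1..n} \<and> (\<forall>i\<in>{1..n}. \<rho> i \<in> {1..n})) \<and>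
    (\<forall>i\<in>{1..n}. \<forall>j\<in>{1..n}. \<exists>!\<rho>. \<rho> \<in> R \<and> \<rho> i = j)"
  proof (rule regular_relation_decomposition)
    fix j assume "j \<in> {1..n}"
    then have "{i \<in> {1..n}. j \<in> {1..n}} = {1..n}"
      by blast
    then show "card {i \<in> {1..n}. j \<in> {1..n}} = n"
      by simp
  qed auto
  then show ?thesis
    unfolding decomposes_def by (metis mem_Collect_eq subsetI)
qed

section \<open>Linear functionals\<close>

text \<open>The functional with value \<open>g \<sigma>\<close> on each basis vector
  \<open>\<sigma>\<close>. The choice \<open>perm_matrix \<sigma> i j\<close> for
  \<open>g \<sigma>\<close> reads off a matrix entry, and the constant 1 gives the sum of the
  coefficients.\<close>

definition pairing :: "nat \<Rightarrow> ((nat \<Rightarrow> nat) \<Rightarrow> rat) \<Rightarrow> ((nat \<Rightarrow> nat) \<Rightarrow>\<^sub>0 rat) \<Rightarrow> rat" where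
  "pairing n g x = (\<Sum>\<sigma>\<in>Sym n. Poly_Mapping.lookup x \<sigma> * g \<sigma>)"

lemma pairing_add: "pairing n g (x + y) = pairing n g x + pairing n g y"
  and pairing_diff: "pairing n g (x - y) = pairing n g x - pairing n g y"
  and pairing_scale: "pairing n g (qscale c x) = c * pairing n g x"
  and pairing_zero: "pairing n g 0 = 0"
  by (simp_all add: pairing_def lookup_add lookup_minus algebra_simps sum.distrib
      sum_subtractf sum_distrib_left)

lemma pairing_sum: "pairing n g (\<Sum>a\<in>A. x a) = (\<Sum>a\<in>A. pairing n g (x a))"
  by (induction A rule: infinite_finite_induct) (simp_all add: pairing_add pairing_zero)

lemma pairing_fun_add: "pairing n (\<lambda>\<sigma>. g \<sigma> + h \<sigma>) x = pairing n g x + pairing n h x"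
  by (simp add: pairing_def algebra_simps sum.distrib)

lemma pairing_fun_scale: "pairing n (\<lambda>\<sigma>. a * g \<sigma>) x = a * pairing n g x"
  by (simp add: pairing_def algebra_simps sum_distrib_left)

lemma pairing_fun_sum: "pairing n (\<lambda>\<sigma>. \<Sum>i\<in>I. g i \<sigma>) x = (\<Sum>i\<in>I. pairing n (g i) x)"
  unfolding pairing_def sum_distrib_left by (rule sum.swap)

lemma pairing_single: "\<sigma> \<in> Sym n \<Longrightarrow> pairing n g (Poly_Mapping.single \<sigma> c) = c * g \<sigma>"
  using finite_Sym[of n] by (simp add: pairing_def lookup_single when_def if_distribR sum.delta
      if_distrib[of "\<lambda>x. x * _"] cong: if_cong)

lemma subspace_pairing: "qvs.subspace {x. pairing n g x = 0}"
  by (simp add: qvs.subspace_def pairing_add pairing_scale pairing_zero)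

section \<open>The flat space through matrix entries; latin elements are flat\<close>

lemma flat_space_iff:
  "x \<in> flat_space n \<longleftrightarrow> x \<in> QSym n \<and>
    (\<exists>c. \<forall>i\<in>{1..n}. \<forall>j\<in>{1..n}. pairing n (\<lambda>\<sigma>. perm_matrix \<sigma> i j) x = c)"
  by (simp add: flat_space_def pairing_def ones_matrix_def)

lemma QSym_iff: "x \<in> QSym n \<longleftrightarrow> (\<forall>\<sigma>. \<sigma> \<notin> Sym n \<longrightarrow> Poly_Mapping.lookup x \<sigma> = 0)"
  unfolding QSym_def mem_Collect_eq subset_iff in_keys_iff by blast

lemma subspace_QSym: "qvs.subspace (QSym n)"
  by (rule qvs.subspaceI) (simp_all add: QSym_iff lookup_add)

lemma QSym_expand:
  assumes "x \<in> QSym n"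
  shows "x = (\<Sum>\<sigma>\<in>Sym n. qscale (Poly_Mapping.lookup x \<sigma>) (Poly_Mapping.single \<sigma> 1))"
proof (rule poly_mapping_eqI)
  fix \<tau>
  have "\<tau> \<notin> Sym n \<Longrightarrow> Poly_Mapping.lookup x \<tau> = 0"
    using assms unfolding QSym_iff by blast
  then show "Poly_Mapping.lookup x \<tau> =
      Poly_Mapping.lookup (\<Sum>\<sigma>\<in>Sym n. qscale (Poly_Mapping.lookup x \<sigma>) (Poly_Mapping.single \<sigma> 1)) \<tau>"
    using finite_Sym[of n] by (simp add: lookup_sum lookup_single when_def sum.delta
      if_distrib[of "\<lambda>y. _ * y"] cong: if_cong)
qed

lemma single_in_QSym: "\<sigma> \<in> Sym n \<Longrightarrow> Poly_Mapping.single \<sigma> c \<in> QSym n"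
  by (auto simp: QSym_def)

lemma subspace_flat_space: "qvs.subspace (flat_space n)"
proof (rule qvs.subspaceI)
  show "0 \<in> flat_space n"
    using qvs.subspace_0[OF subspace_QSym] by (auto simp: flat_space_iff pairing_zero)
next
  fix x y assume "x \<in> flat_space n" "y \<in> flat_space n"
  then obtain c d where "x \<in> QSym n" "y \<in> QSym n"
    and "\<forall>i\<in>{1..n}. \<forall>j\<in>{1..n}. pairing n (\<lambda>\<sigma>. perm_matrix \<sigma> i j) x = c"
    and "\<forall>i\<in>{1..n}. \<forall>j\<in>{1..n}. pairing n (\<lambda>\<sigma>. perm_matrix \<sigma> i j) y = d"
    unfolding flat_space_iff by blast
  then show "x + y \<in> flat_space n"
    unfolding flat_space_iff
    by (intro conjI exI[of _ "c + d"]) (simp_all add: pairing_add qvs.subspace_add[OF subspace_QSym])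
next
  fix a x assume "x \<in> flat_space n"
  then obtain c where "x \<in> QSym n"
    and "\<forall>i\<in>{1..n}. \<forall>j\<in>{1..n}. pairing n (\<lambda>\<sigma>. perm_matrix \<sigma> i j) x = c"
    unfolding flat_space_iff by blast
  then show "qscale a x \<in> flat_space n"
    unfolding flat_space_iff
    by (intro conjI exI[of _ "a * c"]) (simp_all add: pairing_scale qvs.subspace_scale[OF subspace_QSym])
qed

lemma pairing_perm_sum:
  assumes "R \<subseteq> Sym n"
  shows "pairing n g (perm_sum R) = (\<Sum>\<sigma>\<in>R. g \<sigma>)"
  unfolding pairing_sum using assms by (intro sum.cong) (auto simp: pairing_single)

lemma pairing_perm_matrix_decomposition:
  assumes R: "decomposes n R" and ij: "i \<in> {1..n}" "j \<in> {1..n}"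
  shows "pairing n (\<lambda>\<sigma>. perm_matrix \<sigma> i j) (perm_sum R) = 1"
proof -
  obtain \<sigma> where \<sigma>: "\<sigma> \<in> R" "\<sigma> i = j" "\<And>\<tau>. \<tau> \<in> R \<Longrightarrow> \<tau> i = j \<Longrightarrow> \<tau> = \<sigma>"
    using R ij unfolding decomposes_def by metis
  have RS: "R \<subseteq> Sym n"
    using R by (simp add: decomposes_def)
  then have "finite R"
    using finite_Sym finite_subset by blast
  have "perm_matrix \<tau> i j = (if \<tau> = \<sigma> then 1 else 0)" if "\<tau> \<in> R" for \<tau>
    unfolding perm_matrix_def using \<sigma>(2) \<sigma>(3)[OF that] by metis
  then have "(\<Sum>\<tau>\<in>R. perm_matrix \<tau> i j) = (\<Sum>\<tau>\<in>R. if \<tau> = \<sigma> then 1 else 0)"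
    by (intro sum.cong) auto
  then show ?thesis
    using RS \<sigma>(1) \<open>finite R\<close> by (simp add: pairing_perm_sum)
qed

lemma perm_sum_decomposition_flat:
  assumes "decomposes n R"
  shows "perm_sum R \<in> flat_space n"
proof -
  have "perm_sum R \<in> QSym n"
    using assms by (intro qvs.subspace_sum[OF subspace_QSym] single_in_QSym) (auto simp: decomposes_def)
  then show ?thesis
    using pairing_perm_matrix_decomposition[OF assms] unfolding flat_space_iff by blast
qed

lemma latin_span_subset_flat_space: "latin_span n \<subseteq> flat_space n"
  unfolding latin_span_def
  by (rule qvs.span_minimal)
    (auto simp: latin_element_def subspace_flat_space
      intro!: perm_sum_decomposition_flat symbol_perms_decomposes)

section \<open>Line sums, separating functionals and the inclusion of the flat space in the latin
  span\<close>

lemma sum_perm_matrix_row: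
  assumes "\<sigma> permutes {1..n}" "i \<in> {1..n}"
  shows "(\<Sum>j\<in>{1..n}. g j * perm_matrix \<sigma> i j) = g (\<sigma> i)"
  using assms permutes_in_image[OF assms(1), of i]
  by (simp add: perm_matrix_def if_distrib[of "\<lambda>y. _ * y"] sum.delta' cong: if_cong)

text \<open>Each row of a permutation matrix contains exactly one 1; the right-hand side is the
  coefficient sum of \<open>x\<close> over \<open>Sym n\<close>.\<close>

lemma sum_pairing_row:
  assumes "i \<in> {1..n}"
  shows "(\<Sum>j\<in>{1..n}. pairing n (\<lambda>\<sigma>. perm_matrix \<sigma> i j) x) = pairing n (\<lambda>_. 1) x"
proof -
  have "(\<Sum>j\<in>{1..n}. perm_matrix \<sigma> i j) = 1" if "\<sigma> \<in> Sym n" for \<sigma>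
    using sum_perm_matrix_row[of \<sigma> n i "\<lambda>_. 1"] that assms by simp
  then show ?thesis
    unfolding pairing_def by (subst sum.swap) (simp flip: sum_distrib_left)
qed

lemma sum_pairing_column:
  assumes "j \<in> {1..n}"
  shows "(\<Sum>i\<in>{1..n}. pairing n (\<lambda>\<sigma>. perm_matrix \<sigma> i j) x) = pairing n (\<lambda>_. 1) x"
proof -
  have "(\<Sum>i\<in>{1..n}. perm_matrix \<sigma> i j) = 1" if "\<sigma> \<in> Sym n" for \<sigma>
  proof -
    have \<sigma>: "\<sigma> permutes {1..n}"
      using that by simp
    have "perm_matrix \<sigma> i j = (if i = inv \<sigma> j then 1 else 0)" for i
      using permutes_inverses[OF \<sigma>] by (auto simp: perm_matrix_def)
    then show ?thesis
      using permutes_in_image[OF permutes_inv[OF \<sigma>], of j] assms by simp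
  qed
  then show ?thesis
    unfolding pairing_def by (subst sum.swap) (simp flip: sum_distrib_left)
qed

lemma flat_pairing_total:
  assumes "1 \<le> n" "\<And>i j. i \<in> {1..n} \<Longrightarrow> j \<in> {1..n} \<Longrightarrow> pairing n (\<lambda>\<sigma>. perm_matrix \<sigma> i j) x = c"
  shows "pairing n (\<lambda>_. 1) x = of_nat n * c"
  using sum_pairing_row[of 1 n x] assms by simp

text \<open>A basis of \<open>W\<close> stays independent when \<open>v\<close> is added, so the
  values 0 on the basis and 1 on \<open>v\<close> extend linearly.\<close>

lemma separating_functional:
  assumes "qvs.subspace W" "v \<notin> W"
  obtains \<phi> where "Vector_Spaces.linear qscale ((*) :: rat \<Rightarrow> rat \<Rightarrow> rat) \<phi>" "\<And>w. w \<in> W \<Longrightarrow> \<phi> w = 0" "\<phi> v = 1"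
proof -
  interpret vector_space_pair qscale "(*) :: rat \<Rightarrow> rat \<Rightarrow> rat"
    by unfold_locales (auto simp: algebra_simps)
  obtain B where B: "B \<subseteq> W" "qvs.independent B" "W \<subseteq> qvs.span B"
    using qvs.maximal_independent_subset .
  have "v \<notin> qvs.span B"
    using assms B(1) qvs.span_minimal by blast
  then have "qvs.independent (insert v B)" "v \<notin> B"
    using B(2) by (auto simp: qvs.independent_insert qvs.span_base)
  then obtain \<phi> where \<phi>: "Vector_Spaces.linear qscale (*) \<phi>" "\<forall>x\<in>insert v B. \<phi> x = (if x = v then 1 else 0)"
    using linear_independent_extend[of "insert v B" "\<lambda>x. if x = v then 1 else 0"] by blast
  interpret Vector_Spaces.linear qscale "(*)" \<phi>
    by (rule \<phi>(1))
  have "W \<subseteq> {x. \<phi> x = 0}"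
  proof -
    have "qvs.span B \<subseteq> {x. \<phi> x = 0}"
      using \<phi>(2) \<open>v \<notin> B\<close> by (intro qvs.span_minimal) (auto simp: qvs.subspace_def zero add scale)
    then show ?thesis
      using B(3) by blast
  qed
  then show thesis
    using that \<phi> by auto
qed

text \<open>A functional vanishing on the latin span satisfies the switch identity on basis vectors,
  hence is a linear form in the matrix entries and the coefficient sum. On flat elements it depends
  only on the common entry, and one latin square shows that it is zero there.\<close>

lemma flat_space_subset_latin_span:
  assumes n: "7 \<le> n"
  shows "flat_space n \<subseteq> latin_span n"
proof
  fix v assume v: "v \<in> flat_space n"
  show "v \<in> latin_span n"
  proof (rule ccontr)
    assume "v \<notin> latin_span n"
    then obtain \<phi> where lin: "Vector_Spaces.linear qscale ((*) :: rat \<Rightarrow> rat \<Rightarrow> rat) \<phi>"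
      and zero: "\<And>w. w \<in> latin_span n \<Longrightarrow> \<phi> w = 0" and one: "\<phi> v = 1"
      using separating_functional[of "latin_span n" v] by (auto simp: latin_span_def)
    interpret \<phi>: Vector_Spaces.linear qscale "(*)" \<phi>
      by (rule lin)
    define f where "f \<sigma> = \<phi> (Poly_Mapping.single \<sigma> 1)" for \<sigma> :: "nat \<Rightarrow> nat"
    interpret switch_invariant "{1..n}" f
    proof
      fix \<sigma> a b A B
      assume \<sigma>: "\<sigma> permutes {1..n}" and a: "a permutes A" and b: "b permutes B"
        and AB: "A \<inter> B = {}" "A \<union> B = {1..n}"
        and fix_a: "\<And>i. i \<in> A \<Longrightarrow> a i \<noteq> i" and fix_b: "\<And>i. i \<in> B \<Longrightarrow> b i \<noteq> i"
      have aS: "a permutes {1..n}" and bS: "b permutes {1..n}"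
        using a b AB(2) by (auto intro: permutes_subset)
      \<comment> \<open>Exactly one of \<open>a\<close> and \<open>b\<close> moves each
        \<open>i\<close>. This yields both the disjointness and the equality of supports demanded by
        the switch.\<close>
      have cases: "b i = i \<and> a i \<noteq> i \<or> b i \<noteq> i \<and> a (b i) = b i \<and> a i = i" if "i \<in> {1..n}" for i
      proof (cases "i \<in> A")
        case True
        then show ?thesis
          using AB fix_a permutes_not_in[OF b] by blast
      next
        case False
        then have "i \<in> B" "b i \<in> B"
          using AB that permutes_in_image[OF b] by auto
        then show ?thesis
          using AB fix_b permutes_not_in[OF a] by blast
      qed
      have inj: "\<sigma> x = \<sigma> y \<longleftrightarrow> x = y" for x y
        using permutes_inj[OF \<sigma>] by (simp add: inj_eq)
      have "Poly_Mapping.single \<sigma> 1 + Poly_Mapping.single (\<sigma> \<circ> a \<circ> b) 1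
        - (Poly_Mapping.single (\<sigma> \<circ> a) 1 + Poly_Mapping.single (\<sigma> \<circ> b) 1) \<in> latin_span n"
      proof (rule switch_in_latin_span)
        fix i assume "i \<in> {1..n}"
        from cases[OF this] show "\<sigma> i \<noteq> (\<sigma> \<circ> a \<circ> b) i" "{(\<sigma> \<circ> a) i, (\<sigma> \<circ> b) i} = {\<sigma> i, (\<sigma> \<circ> a \<circ> b) i}"
          by (auto simp: inj)
      qed (use n \<sigma> aS bS in \<open>auto intro!: permutes_compose\<close>)
      from zero[OF this] show "f \<sigma> + f (\<sigma> \<circ> a \<circ> b) = f (\<sigma> \<circ> a) + f (\<sigma> \<circ> b)"
        by (simp add: f_def \<phi>.add \<phi>.diff)
    qed (use n in auto)
    obtain M c where M: "\<And>\<sigma>. \<sigma> permutes {1..n} \<Longrightarrow> f \<sigma> = (\<Sum>i\<in>{1..n}. M i (\<sigma> i)) + c"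
      using switch_invariant_linear by blast
    have M_entries: "f \<sigma> = (\<Sum>i\<in>{1..n}. \<Sum>j\<in>{1..n}. M i j * perm_matrix \<sigma> i j) + c"
      if "\<sigma> permutes {1..n}" for \<sigma>
      by (simp add: M[OF that] sum_perm_matrix_row[OF that] del: One_nat_def)
    \<comment> \<open>The value of \<open>\<phi>\<close> on a flat element with all entries 1; its
      coefficient sum is \<open>n\<close>, which explains the factor of \<open>c\<close>.\<close>
    define K where "K = (\<Sum>i\<in>{1..n}. \<Sum>j\<in>{1..n}. M i j) + c * of_nat n"
    have \<phi>_flat: "\<phi> x = d * K"
      if x: "x \<in> QSym n"
        and d: "\<And>i j. i \<in> {1..n} \<Longrightarrow> j \<in> {1..n} \<Longrightarrow> pairing n (\<lambda>\<sigma>. perm_matrix \<sigma> i j) x = d" for x d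
    proof -
      have "\<phi> x = \<phi> (\<Sum>\<sigma>\<in>Sym n. qscale (Poly_Mapping.lookup x \<sigma>) (Poly_Mapping.single \<sigma> 1))"
        using QSym_expand[OF x] by simp
      also have "\<dots> = pairing n f x"
        by (simp add: \<phi>.sum \<phi>.scale f_def pairing_def)
      also have "\<dots> = pairing n (\<lambda>\<sigma>. (\<Sum>i\<in>{1..n}. \<Sum>j\<in>{1..n}. M i j * perm_matrix \<sigma> i j) + c) x"
        unfolding pairing_def using M_entries by (intro sum.cong) simp_all
      also have "\<dots> = (\<Sum>i\<in>{1..n}. \<Sum>j\<in>{1..n}. M i j * pairing n (\<lambda>\<sigma>. perm_matrix \<sigma> i j) x)
          + c * pairing n (\<lambda>_. 1) x"
        using pairing_fun_scale[of n c "\<lambda>_. 1" x]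
        by (simp add: pairing_fun_add pairing_fun_sum pairing_fun_scale)
      also have "\<dots> = (\<Sum>i\<in>{1..n}. \<Sum>j\<in>{1..n}. M i j * d) + c * (of_nat n * d)"
        using d flat_pairing_total[of n x d] n by simp
      also have "\<dots> = d * K"
        unfolding K_def sum_distrib_right[symmetric] by (simp only: distrib_left mult_ac)
      finally show ?thesis .
    qed
    obtain R where R: "decomposes n R"
      using decomposition_exists by blast
    \<comment> \<open>A decomposition has common entry 1 and also lies in the latin span, where
      \<open>\<phi>\<close> vanishes; hence \<open>K = 0\<close>.\<close>
    have "\<phi> (perm_sum R) = 1 * K"
      using perm_sum_decomposition_flat[OF R] pairing_perm_matrix_decomposition[OF R]
      by (intro \<phi>_flat) (auto simp: flat_space_iff)
    moreover have "\<phi> (perm_sum R) = 0"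
      using perm_sum_decomposition_in_latin_span[OF _ R] n by (intro zero) auto
    ultimately have "K = 0"
      by simp
    moreover obtain d where "\<phi> v = d * K"
    proof -
      obtain d where "v \<in> QSym n"
        "\<forall>i\<in>{1..n}. \<forall>j\<in>{1..n}. pairing n (\<lambda>\<sigma>. perm_matrix \<sigma> i j) v = d"
        using v unfolding flat_space_iff by blast
      then have "\<phi> v = d * K"
        by (intro \<phi>_flat) auto
      then show thesis
        by (rule that)
    qed
    ultimately show False
      using one by simp
  qed
qed

section \<open>Dimension of the flat space\<close>

text \<open>The kernel of \<open>T p\<close> is a subspace containing \<open>B\<close> and all other
  \<open>w q\<close>, hence their span, but not \<open>w p\<close>. So each \<open>w p\<close> is
  new and enlarges the independent set by one.\<close>

lemma independent_Un_dual_family: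
  assumes "finite Q" and "finite B" and B: "qvs.independent B"
    and "\<And>p. p \<in> Q \<Longrightarrow> qvs.subspace {x. T p x = (0 :: rat)}"
    and "\<And>p b. p \<in> Q \<Longrightarrow> b \<in> B \<Longrightarrow> T p b = 0"
    and "\<And>p q. p \<in> Q \<Longrightarrow> q \<in> Q \<Longrightarrow> T p (w q) = (if p = q then 1 else 0)"
  shows "qvs.independent (B \<union> w ` Q) \<and> card (B \<union> w ` Q) = card B + card Q"
  using assms(1,4-)
proof (induction Q rule: finite_induct)
  case (insert p Q)
  have "qvs.span (B \<union> w ` Q) \<subseteq> {x. T p x = 0}"
    using insert by (intro qvs.span_minimal) auto
  moreover have "T p (w p) = 1"
    using insert by simp
  ultimately have "w p \<notin> qvs.span (B \<union> w ` Q)"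
    by auto
  then have "qvs.independent (insert (w p) (B \<union> w ` Q))" "w p \<notin> B \<union> w ` Q"
    using insert by (auto simp: qvs.independent_insert qvs.span_base)
  then show ?case
    using insert \<open>finite B\<close> by simp
qed (use B in simp)

lemma dim_QSym: "qvs.dim (QSym n) = fact n"
proof -
  define s where "s \<sigma> = Poly_Mapping.single \<sigma> (1 :: rat)" for \<sigma> :: "nat \<Rightarrow> nat"
  have "qvs.independent ({} \<union> s ` Sym n) \<and>
      card ({} \<union> s ` Sym n) = card ({} :: ((nat \<Rightarrow> nat) \<Rightarrow>\<^sub>0 rat) set) + card (Sym n)"
    by (rule independent_Un_dual_family[where T = "\<lambda>\<sigma> x. Poly_Mapping.lookup x \<sigma>"])
      (auto simp: finite_permutations qvs.independent_empty qvs.subspace_def lookup_add s_def lookup_single when_def)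
  moreover have "s ` Sym n \<subseteq> QSym n"
    by (auto simp: s_def single_in_QSym)
  moreover have "QSym n \<subseteq> qvs.span (s ` Sym n)"
  proof
    fix x assume "x \<in> QSym n"
    then have "x = (\<Sum>\<sigma>\<in>Sym n. qscale (Poly_Mapping.lookup x \<sigma>) (s \<sigma>))"
      unfolding s_def by (rule QSym_expand)
    moreover have "\<dots> \<in> qvs.span (s ` Sym n)"
      by (intro qvs.span_sum qvs.span_scale qvs.span_base imageI)
    ultimately show "x \<in> qvs.span (s ` Sym n)"
      by simp
  qed
  ultimately show ?thesis
    by (intro qvs.dim_unique[of "s ` Sym n"]) (auto simp: card_permutations)
qed

text \<open>Pairing with this function compares the entry at \<open>p\<close> with the coefficient
  sum divided by \<open>n\<close>, the only possible common entry of a flat element.\<close>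

definition block_defect :: "nat \<Rightarrow> nat \<times> nat \<Rightarrow> (nat \<Rightarrow> nat) \<Rightarrow> rat" where
  "block_defect n p \<sigma> = perm_matrix \<sigma> (fst p) (snd p) - 1 / of_nat n"

lemma pairing_block_defect:
  "pairing n (block_defect n (i, j)) x =
    pairing n (\<lambda>\<sigma>. perm_matrix \<sigma> i j) x - pairing n (\<lambda>_. 1) x / of_nat n"
  by (simp add: pairing_def block_defect_def algebra_simps sum_subtractf sum_divide_distrib)

text \<open>All line sums equal the coefficient sum, so the upper left block of size
  \<open>n - 1\<close> determines the last row and the last column.\<close>

lemma flat_space_iff_block_defect:
  assumes n: "1 \<le> n"
  shows "x \<in> flat_space n \<longleftrightarrow>
    x \<in> QSym n \<and> (\<forall>p\<in>{1..<n} \<times> {1..<n}. pairing n (block_defect n p) x = 0)"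
    (is "_ \<longleftrightarrow> _ \<and> ?Z")
proof -
  define t where "t = pairing n (\<lambda>_. 1) x / of_nat n"
  define A where "A i j = pairing n (\<lambda>\<sigma>. perm_matrix \<sigma> i j) x" for i j
  have Z: "?Z \<longleftrightarrow> (\<forall>i\<in>{1..<n}. \<forall>j\<in>{1..<n}. A i j = t)"
    by (auto simp: pairing_block_defect A_def t_def)
  have split: "(\<Sum>j\<in>{1..n}. g j) = (\<Sum>j\<in>{1..<n}. g j) + g n" for g :: "nat \<Rightarrow> rat"
    using n by (simp add: sum.last_plus add.commute)
  have total: "pairing n (\<lambda>_. 1) x = of_nat n * t"
    using n by (simp add: t_def)
  have row: "(\<Sum>j\<in>{1..n}. A i j) = of_nat n * t" if "i \<in> {1..n}" for i
    unfolding A_def total[symmetric] by (rule sum_pairing_row[OF that])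
  have column: "(\<Sum>i\<in>{1..n}. A i j) = of_nat n * t" if "j \<in> {1..n}" for j
    unfolding A_def total[symmetric] by (rule sum_pairing_column[OF that])
  have last: "g n = t" if "(\<Sum>j\<in>{1..n}. g j) = of_nat n * t" "\<And>j. j \<in> {1..<n} \<Longrightarrow> g j = t" for g
  proof -
    have "(\<Sum>j\<in>{1..<n}. g j) = of_nat (n - 1) * t"
      using that(2) by simp
    then show ?thesis
      using that(1) n unfolding split by (simp add: of_nat_diff algebra_simps)
  qed
  have "\<forall>i\<in>{1..n}. \<forall>j\<in>{1..n}. A i j = t" if ?Z
  proof -
    have in_block: "A i j = t" if "i \<in> {1..<n}" "j \<in> {1..<n}" for i j
      using \<open>?Z\<close> Z that by blast
    \<comment> \<open>The last column is settled first, above the corner; then every column,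
      including the last, yields its entry in row \<open>n\<close>.\<close>
    have last_col: "A i n = t" if "i \<in> {1..<n}" for i
      using that by (intro last[of "A i"] row in_block) auto
    have most: "A i j = t" if "i \<in> {1..<n}" "j \<in> {1..n}" for i j
      using in_block last_col that by (cases "j = n") auto
    have last_row: "A n j = t" if "j \<in> {1..n}" for j
      using that by (intro last[of "\<lambda>i. A i j"] column most) auto
    show ?thesis
    proof (intro ballI)
      fix i j assume "i \<in> {1..n}" "j \<in> {1..n}"
      then show "A i j = t"
        using most last_row by (cases "i = n") auto
    qed
  qed
  moreover have "?Z" if "\<forall>i\<in>{1..n}. \<forall>j\<in>{1..n}. A i j = c" for c
    using that flat_pairing_total[of n x c] n unfolding Z by (auto simp: A_def t_def)
  ultimately show ?thesis
    unfolding flat_space_iff A_def by blast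
qed

text \<open>The block conditions have a dual family \<open>w\<close>, so a basis of the flat space
  together with \<open>w\<close> is a basis of \<open>QSym n\<close>.\<close>

lemma dim_flat_space:
  assumes n: "1 \<le> n"
  shows "qvs.dim (flat_space n) + (n - 1)\<^sup>2 = fact n"
proof -
  define P where "P = {1..<n} \<times> {1..<n}"
  have "finite P" "card P = (n - 1)\<^sup>2"
    by (auto simp: P_def power2_eq_square card_cartesian_product)
  define T where "T p = pairing n (block_defect n p)" for p
  \<comment> \<open>The matrix of \<open>w (i, j)\<close> has 1 at \<open>(i, j)\<close> and
    \<open>(n, n)\<close>, -1 at \<open>(i, n)\<close> and \<open>(n, j)\<close>, and 0 elsewhere:
    inside the block only \<open>(i, j)\<close> is seen. Its coefficients sum to 0, so the terms
    \<open>1 / of_nat n\<close> cancel.\<close>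
  define w where "w p = (case p of (i, j) \<Rightarrow>
    Poly_Mapping.single (transpose i j) (1 :: rat) -
    Poly_Mapping.single (transpose i j \<circ> transpose i n) 1)" for p
  have wQ: "w p \<in> QSym n" if "p \<in> P" for p
  proof -
    have "transpose (fst p) (snd p) permutes {1..n}"
      "transpose (fst p) (snd p) \<circ> transpose (fst p) n permutes {1..n}"
      using that by (auto simp: P_def intro!: permutes_compose permutes_swap_id)
    then show ?thesis
      using qvs.subspace_diff[OF subspace_QSym single_in_QSym single_in_QSym]
      by (simp add: w_def case_prod_beta)
  qed
  have Tw: "T p (w q) = (if p = q then 1 else 0)" if "p \<in> P" "q \<in> P" for p q
  proof -
    obtain k l i j where pq: "p = (k, l)" "q = (i, j)"
      by fastforce
    have "transpose i j permutes {1..n}" "transpose i j \<circ> transpose i n permutes {1..n}"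
      using that pq by (auto simp: P_def intro!: permutes_compose permutes_swap_id)
    then have "T p (w q) = perm_matrix (transpose i j) k l
        - perm_matrix (transpose i j \<circ> transpose i n) k l"
      by (simp add: T_def w_def pq pairing_diff pairing_single block_defect_def)
    also have "\<dots> = (if p = q then 1 else 0)"
      using that pq by (auto simp: P_def perm_matrix_def transpose_def)
    finally show ?thesis .
  qed
  obtain B where B: "B \<subseteq> flat_space n" "qvs.independent B" "flat_space n \<subseteq> qvs.span B"
    "card B = qvs.dim (flat_space n)"
    using qvs.basis_exists .
  have BQ: "B \<subseteq> QSym n"
    using B(1) by (auto simp: flat_space_iff)
  obtain E where E: "E \<subseteq> QSym n" "qvs.independent E" "QSym n \<subseteq> qvs.span E" "card E = fact n"
    using qvs.basis_exists dim_QSym by metis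
  \<comment> \<open>An infinite set has \<open>card\<close> 0, whereas \<open>fact n\<close> is
    nonzero.\<close>
  then have "finite E"
    by (metis card.infinite fact_nonzero)
  then have "finite B"
    using qvs.independent_span_bound B(2) BQ E(3) by blast
  have "qvs.independent (B \<union> w ` P) \<and> card (B \<union> w ` P) = card B + card P"
  proof (rule independent_Un_dual_family[where T = T])
    show "T p b = 0" if "p \<in> P" "b \<in> B" for p b
      using that B(1) flat_space_iff_block_defect[OF n] by (auto simp: T_def P_def)
  qed (use \<open>finite P\<close> \<open>finite B\<close> B(2) Tw in \<open>auto simp: T_def subspace_pairing\<close>)
  moreover have "QSym n \<subseteq> qvs.span (B \<union> w ` P)"
  proof
    fix x assume x: "x \<in> QSym n"
    \<comment> \<open>\<open>y\<close> has the same block defects as \<open>x\<close>, so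
      \<open>x - y\<close> is flat.\<close>
    define y where "y = (\<Sum>p\<in>P. qscale (T p x) (w p))"
    have yQ: "y \<in> QSym n"
      unfolding y_def using wQ
      by (intro qvs.subspace_sum[OF subspace_QSym] qvs.subspace_scale[OF subspace_QSym])
    have "T p y = T p x" if "p \<in> P" for p
    proof -
      have "T p y = (\<Sum>q\<in>P. T q x * T p (w q))"
        by (simp add: y_def T_def pairing_sum pairing_scale)
      also have "\<dots> = (\<Sum>q\<in>P. if p = q then T q x else 0)"
        using that by (intro sum.cong) (auto simp: Tw)
      finally show ?thesis
        using that \<open>finite P\<close> by simp
    qed
    then have "x - y \<in> flat_space n"
      using x yQ qvs.subspace_diff[OF subspace_QSym] unfolding flat_space_iff_block_defect[OF n]
      by (auto simp: T_def P_def pairing_diff)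
    then have "x - y \<in> qvs.span (B \<union> w ` P)"
      using B(3) qvs.span_mono[of B "B \<union> w ` P"] by auto
    moreover have "y \<in> qvs.span (B \<union> w ` P)"
      unfolding y_def by (intro qvs.span_sum qvs.span_scale qvs.span_base) auto
    ultimately show "x \<in> qvs.span (B \<union> w ` P)"
      using qvs.span_add by fastforce
  qed
  ultimately have "qvs.dim (QSym n) = card B + card P"
    using BQ wQ by (intro qvs.dim_unique[of "B \<union> w ` P"]) auto
  then show ?thesis
    using B(4) \<open>card P = (n - 1)\<^sup>2\<close> by (simp add: dim_QSym)
qed

theorem theorem2p1:
  shows "\<exists>n0::nat. \<forall>n\<ge>n0.
    int (qvs.dim (latin_span n)) = fact n - (int n - 1)^2 \<and> latin_span n = flat_space n"
proof (intro exI[of _ 7] allI impI)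
  \<comment> \<open>The threshold 7 is the four points of two disjoint transpositions plus three for
    a derangement whose square is a derangement.\<close>
  fix n :: nat assume n: "7 \<le> n"
  have eq: "latin_span n = flat_space n"
    using latin_span_subset_flat_space flat_space_subset_latin_span[OF n] by (rule equalityI)
  have "int (qvs.dim (flat_space n)) + int ((n - 1)\<^sup>2) = int (fact n)"
    using dim_flat_space[of n] n by (metis of_nat_add le_trans one_le_numeral)
  moreover have "int ((n - 1)\<^sup>2) = (int n - 1)\<^sup>2"
    using n by (simp add: of_nat_diff)
  ultimately show "int (qvs.dim (latin_span n)) = fact n - (int n - 1)^2 \<and> latin_span n = flat_space n"
    using eq by simp
qed

end
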